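(* For every distinguished variety $\Omega$ in $\mathbf{\Theta}_n$, the closure $\overline\Omega$ is polynomially convex; that is, for every $x\in\mathbb C^n\setminus\overline\Omega$ there is a polynomial $f\in\mathbb C[z_1,\ldots,z_n]$ with $|f(x)|>\sup_{\overline\Omega}|f|$.
   Context: Fix positive integers $n$, $m$, $p$ with $p\mid m$, and put $q=m/p$. $\mathbb D$ is the open unit disc in $\mathbb C$ and $\mathbb T$ the unit circle. Let $s_i(z_1,\ldots,z_n)=\sum_{1\le k_1<\cdots<k_i\le n}z_{k_1}\cdots z_{k_i}$. Define $\boldsymbol\theta=(\theta_1,\ldots,\theta_n):\mathbb C^n\to\mathbb C^n$ by $\theta_i(z)=s_i(z_1^m,\ldots,z_n^m)$ for $1\le i\le n-1$ and $\theta_n(z)=(z_1\cdots z_n)^q$. Set $\mathbf{\Theta}_n=\boldsymbol\theta(\mathbb D^n)$; $\partial\mathbf{\Theta}_n$ is its topological boundary and $b\mathbf{\Theta}_n=\boldsymbol\theta(\mathbb T^n)$ its distinguished boundary. A set $\Omega\subseteq\mathbf{\Theta}_n$ is a distinguished variety in $\mathbf{\Theta}_n$ if it is nonempty, there is an irreducible affine algebraic set $V\subseteq\mathbb C^n$ (common zero set of a collection of polynomials in $\mathbb C[z_1,\ldots,z_n]$) with $\Omega=V\cap\mathbf{\Theta}_n$, and $\emptyset\ne\overline\Omega\cap\partial\mathbf{\Theta}_n\subseteq b\mathbf{\Theta}_n$. *)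

theory Defs
  imports "HOL-Analysis.Analysis" "HOL-Library.Poly_Mapping"
begin

text \<open>
  The space \<open>\<complex>\<^sup>n\<close> is \<open>complex ^ 'n\<close> for a finite linearly ordered index type \<open>'n\<close>, with
  \<open>n = CARD('n) \<ge> 1\<close>. The order fixes which coordinate is the first, the second, and so on:
  \<open>coord_number i\<close> is the number in \<open>{1..n}\<close> of the coordinate with index \<open>i\<close>.
\<close>

definition coord_number :: "'n::{finite,linorder} \<Rightarrow> nat" where
  "coord_number i = card {..i}"

definition elem_sym :: "nat \<Rightarrow> complex ^ 'n \<Rightarrow> complex" where
  "elem_sym k z = (\<Sum>A \<in> {A :: 'n set. card A = k}. \<Prod>j\<in>A. z $ j)"

definition theta :: "nat \<Rightarrow> nat \<Rightarrow> complex ^ 'n::{finite,linorder} \<Rightarrow> complex ^ 'n::{finite,linorder}" where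
  "theta m p z =
    (\<chi> i. if coord_number i < CARD('n)
          then elem_sym (coord_number i) (\<chi> j. (z $ j) ^ m)
          else (\<Prod>j\<in>UNIV. z $ j) ^ (m div p))"

definition polydisc :: "(complex ^ 'n) set" where
  "polydisc = {z. \<forall>j. z $ j \<in> ball 0 1}"

definition torus :: "(complex ^ 'n) set" where
  "torus = {z. \<forall>j. z $ j \<in> sphere 0 1}"

definition Theta_domain :: "nat \<Rightarrow> nat \<Rightarrow> (complex ^ 'n::{finite,linorder}) set" where
  "Theta_domain m p = theta m p ` polydisc"

definition distinguished_boundary :: "nat \<Rightarrow> nat \<Rightarrow> (complex ^ 'n::{finite,linorder}) set" where
  "distinguished_boundary m p = theta m p ` torus"

text \<open>
  Polynomials in the variables indexed by \<open>'n\<close>: finitely supported maps from exponent vectors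
  to coefficients.
\<close>

type_synonym 'n cpoly = "('n \<Rightarrow>\<^sub>0 nat) \<Rightarrow>\<^sub>0 complex"

definition eval_cpoly :: "'n cpoly \<Rightarrow> complex ^ 'n \<Rightarrow> complex" where
  "eval_cpoly f z =
    (\<Sum>a \<in> Poly_Mapping.keys f. Poly_Mapping.lookup f a * (\<Prod>j\<in>UNIV. (z $ j) ^ Poly_Mapping.lookup a j))"

definition algebraic_set :: "(complex ^ 'n) set \<Rightarrow> bool" where
  "algebraic_set V \<longleftrightarrow> (\<exists>S :: 'n cpoly set. V = {z. \<forall>f\<in>S. eval_cpoly f z = 0})"

definition irreducible_algebraic_set :: "(complex ^ 'n) set \<Rightarrow> bool" where
  "irreducible_algebraic_set V \<longleftrightarrow>
    algebraic_set V \<and> V \<noteq> {} \<and>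
    (\<forall>V1 V2. algebraic_set V1 \<and> algebraic_set V2 \<and> V = V1 \<union> V2 \<longrightarrow> V = V1 \<or> V = V2)"

definition distinguished_variety ::
    "nat \<Rightarrow> nat \<Rightarrow> (complex ^ 'n::{finite,linorder}) set \<Rightarrow> bool" where
  "distinguished_variety m p \<Omega> \<longleftrightarrow>
    \<Omega> \<subseteq> Theta_domain m p \<and> \<Omega> \<noteq> {} \<and>
    (\<exists>V. irreducible_algebraic_set V \<and> \<Omega> = V \<inter> Theta_domain m p) \<and>
    closure \<Omega> \<inter> frontier (Theta_domain m p) \<noteq> {} \<and>
    closure \<Omega> \<inter> frontier (Theta_domain m p) \<subseteq> distinguished_boundary m p"

text \<open>
  The \<open>bdd_above\<close> conjunct makes the real supremum meaningful, since \<open>Sup\<close> is unspecified on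
  unbounded sets of reals.
\<close>

definition polynomially_convex :: "(complex ^ 'n) set \<Rightarrow> bool" where
  "polynomially_convex K \<longleftrightarrow>
    (\<forall>x. x \<notin> K \<longrightarrow>
      (\<exists>f :: 'n cpoly. bdd_above ((\<lambda>z. cmod (eval_cpoly f z)) ` K) \<and>
        cmod (eval_cpoly f x) > (SUP z\<in>K. cmod (eval_cpoly f z))))"

end

theory Submission
  imports Defs "HOL-Computational_Algebra.Fundamental_Theorem_Algebra"
    "HOL-Computational_Algebra.Formal_Power_Series"
begin

text \<open>
  Let \<open>S\<close> be the preimage of \<open>\<Omega>\<close> in the polydisc. Its closure meets the boundary of the polydisc only
  in the torus, so the sets \<open>{z \<in> S. z\<^sub>k = c}\<close> are compact and relatively open in an algebraic set.
  Over a maximal algebraically independent set of coordinates an irreducible algebraic set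
  generically projects openly (continuity of roots). By Noetherian induction, compact relatively
  open subsets of algebraic sets are finite, and then any two coordinates satisfy a nontrivial
  polynomial relation on \<open>S\<close>. Hence only finitely many points of the closure of \<open>S\<close> have
  \<open>z\<^sub>k = a\<close>, for each \<open>a\<close> of modulus \<open>1\<close>.

  A point \<open>x = \<theta>(z)\<close> of \<open>V\<close> outside the closure \<open>K\<close> of \<open>\<Omega>\<close> has some \<open>z\<^sub>j\<^sup>m\<close> of maximal modulus
  \<open>\<ge> 1\<close>. With \<open>a = z\<^sub>j\<^sup>m\<close> and an affine function \<open>v\<close> with \<open>v(a) = 1\<close> and \<open>|v(s)| < 1\<close> for all other
  \<open>s\<close> with \<open>|s| \<le> |a|\<close>, the power sum \<open>\<Sum>\<^sub>i v(w\<^sub>i\<^sup>m)\<^sup>N\<close> is a polynomial in \<open>\<theta>(w)\<close>. For large \<open>N\<close> it is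
  close to a positive integer at \<open>x\<close> and small on \<open>K\<close> away from the finitely many points with some
  \<open>w\<^sub>i\<^sup>m = a\<close>; multiplying by a polynomial that vanishes at those points and not at \<open>x\<close> separates
  \<open>x\<close> from \<open>K\<close>.
\<close>

section \<open>Polynomial functions\<close>

text \<open>Functions instead of \<open>cpoly\<close> objects, so that closure properties and
  substitution follow by rule induction. The index \<open>T\<close> records which coordinates may
  occur, as elimination requires.\<close>

inductive_set polyfun :: "'n::finite set \<Rightarrow> (complex ^ 'n \<Rightarrow> complex) set" for T where
  const [intro]: "(\<lambda>z. c) \<in> polyfun T"
| coord [intro]: "i \<in> T \<Longrightarrow> (\<lambda>z. z $ i) \<in> polyfun T"
| add [intro]: "f \<in> polyfun T \<Longrightarrow> g \<in> polyfun T \<Longrightarrow> (\<lambda>z. f z + g z) \<in> polyfun T"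
| mult [intro]: "f \<in> polyfun T \<Longrightarrow> g \<in> polyfun T \<Longrightarrow> (\<lambda>z. f z * g z) \<in> polyfun T"

lemma polyfun_uminus: "f \<in> polyfun T \<Longrightarrow> (\<lambda>z. - f z) \<in> polyfun T"
  using polyfun.mult[OF polyfun.const[of "-1"], of f T] by simp

lemma polyfun_diff:
  "f \<in> polyfun T \<Longrightarrow> g \<in> polyfun T \<Longrightarrow> (\<lambda>z. f z - g z) \<in> polyfun T"
  using polyfun.add[OF _ polyfun_uminus, of f T g] by simp

lemma polyfun_power: "f \<in> polyfun T \<Longrightarrow> (\<lambda>z. f z ^ k) \<in> polyfun T"
  by (induction k) (auto intro: polyfun.intros)

lemma polyfun_sum:
  "(\<And>i. i \<in> A \<Longrightarrow> f i \<in> polyfun T) \<Longrightarrow> (\<lambda>z. \<Sum>i\<in>A. f i z) \<in> polyfun T"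
  by (induction A rule: infinite_finite_induct) (auto intro: polyfun.intros)

lemma polyfun_prod:
  "(\<And>i. i \<in> A \<Longrightarrow> f i \<in> polyfun T) \<Longrightarrow> (\<lambda>z. \<Prod>i\<in>A. f i z) \<in> polyfun T"
  by (induction A rule: infinite_finite_induct) (auto intro: polyfun.intros)

lemmas polyfun_intros =
  polyfun.intros polyfun_uminus polyfun_diff polyfun_power polyfun_sum polyfun_prod

lemma polyfun_mono: "f \<in> polyfun S \<Longrightarrow> S \<subseteq> T \<Longrightarrow> f \<in> polyfun T"
  by (induction rule: polyfun.induct) (auto intro: polyfun.intros)

lemma polyfun_cong:
  "f \<in> polyfun T \<Longrightarrow> (\<And>i. i \<in> T \<Longrightarrow> z $ i = w $ i) \<Longrightarrow> f z = f w"
  by (induction rule: polyfun.induct) auto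

lemma continuous_on_polyfun: "f \<in> polyfun T \<Longrightarrow> continuous_on A f"
  by (induction rule: polyfun.induct) (auto intro!: continuous_intros)

lemma polyfun_compose:
  assumes "f \<in> polyfun T" and "\<And>i. i \<in> T \<Longrightarrow> (\<lambda>z. h z $ i) \<in> polyfun S"
  shows "(\<lambda>z. f (h z)) \<in> polyfun S"
  using assms by (induction rule: polyfun.induct) (auto intro: polyfun.intros)

section \<open>Evaluation of polynomials given by their coefficients\<close>

definition monom_val :: "('n::finite \<Rightarrow>\<^sub>0 nat) \<Rightarrow> complex ^ 'n \<Rightarrow> complex" where
  "monom_val a z = (\<Prod>j\<in>UNIV. (z $ j) ^ Poly_Mapping.lookup a j)"

lemma monom_val_add: "monom_val (a + b) z = monom_val a z * monom_val b z"
  by (simp add: monom_val_def lookup_add power_add prod.distrib)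

lemma monom_val_0 [simp]: "monom_val 0 z = 1"
  by (simp add: monom_val_def)

lemma monom_val_single: "monom_val (Poly_Mapping.single i 1) z = z $ i"
proof -
  have "monom_val (Poly_Mapping.single i 1) z = (\<Prod>j\<in>UNIV. if j = i then z $ j else 1)"
    unfolding monom_val_def by (intro prod.cong) (auto simp: lookup_single when_def)
  then show ?thesis by simp
qed

lemma eval_cpoly_superset:
  assumes "finite A" "Poly_Mapping.keys f \<subseteq> A"
  shows "eval_cpoly f z = (\<Sum>a\<in>A. Poly_Mapping.lookup f a * monom_val a z)"
  unfolding eval_cpoly_def monom_val_def[symmetric]
  by (rule sum.mono_neutral_left) (use assms in \<open>auto simp: in_keys_iff\<close>)

lemma eval_cpoly_0 [simp]: "eval_cpoly 0 z = 0"
  by (simp add: eval_cpoly_def)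

lemma eval_cpoly_add: "eval_cpoly (f + g) z = eval_cpoly f z + eval_cpoly g z"
proof -
  let ?A = "Poly_Mapping.keys f \<union> Poly_Mapping.keys g"
  have "eval_cpoly (f + g) z = (\<Sum>a\<in>?A. Poly_Mapping.lookup (f + g) a * monom_val a z)"
    by (rule eval_cpoly_superset) (use keys_add[of f g] in auto)
  also have "\<dots> = eval_cpoly f z + eval_cpoly g z"
    by (simp add: eval_cpoly_superset[of ?A f] eval_cpoly_superset[of ?A g] lookup_add
        distrib_right sum.distrib)
  finally show ?thesis .
qed

lemma eval_cpoly_single: "eval_cpoly (Poly_Mapping.single a c) z = c * monom_val a z"
  by (subst eval_cpoly_superset[of "{a}"]) auto

lemma eval_cpoly_sum: "eval_cpoly (\<Sum>i\<in>A. f i) z = (\<Sum>i\<in>A. eval_cpoly (f i) z)"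
  by (induction A rule: infinite_finite_induct) (auto simp: eval_cpoly_add)

lemma cpoly_sum_monomials:
  "(f :: 'n cpoly) = (\<Sum>a\<in>Poly_Mapping.keys f. Poly_Mapping.single a (Poly_Mapping.lookup f a))"
proof (rule poly_mapping_eqI)
  fix k
  have "(\<Sum>a\<in>Poly_Mapping.keys f. Poly_Mapping.lookup f a when a = k)
      = (\<Sum>a\<in>Poly_Mapping.keys f. if a = k then Poly_Mapping.lookup f a else 0)"
    by (intro sum.cong) (auto simp: when_def)
  also have "\<dots> = Poly_Mapping.lookup f k"
    by (auto simp: in_keys_iff)
  finally show "Poly_Mapping.lookup f k = Poly_Mapping.lookup
      (\<Sum>a\<in>Poly_Mapping.keys f. Poly_Mapping.single a (Poly_Mapping.lookup f a)) k"
    by (simp add: lookup_sum lookup_single)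
qed

lemma eval_cpoly_mult:
  fixes f g :: "'n::finite cpoly"
  shows "eval_cpoly (f * g) z = eval_cpoly f z * eval_cpoly g z"
proof -
  have "f * g = (\<Sum>a\<in>Poly_Mapping.keys f. \<Sum>b\<in>Poly_Mapping.keys g.
      Poly_Mapping.single (a + b) (Poly_Mapping.lookup f a * Poly_Mapping.lookup g b))"
    by (subst cpoly_sum_monomials[of f], subst cpoly_sum_monomials[of g])
      (simp add: sum_product mult_single)
  then show ?thesis
    by (simp add: eval_cpoly_sum eval_cpoly_single monom_val_add eval_cpoly_superset[of "Poly_Mapping.keys f" f]
        eval_cpoly_superset[of "Poly_Mapping.keys g" g] sum_product algebra_simps)
qed

lemma eval_cpoly_polyfun: "eval_cpoly f \<in> polyfun UNIV"
  unfolding eval_cpoly_def[abs_def] by (intro polyfun_intros) auto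

text \<open>Converse of \<open>eval_cpoly_polyfun\<close>: constants and coordinates are
  evaluations, and evaluation respects sums and products.\<close>

lemma polyfun_eval_cpoly:
  assumes "f \<in> polyfun UNIV"
  obtains g :: "'n::finite cpoly" where "\<And>z. f z = eval_cpoly g z"
proof -
  have "\<exists>g :: 'n cpoly. \<forall>z. f z = eval_cpoly g z"
    using assms
  proof (induction rule: polyfun.induct)
    case (const c)
    show ?case by (rule exI[of _ "Poly_Mapping.single 0 c"]) (simp add: eval_cpoly_single)
  next
    case (coord i)
    show ?case
      by (rule exI[of _ "Poly_Mapping.single (Poly_Mapping.single i 1) 1"])
        (simp add: eval_cpoly_single monom_val_single del: One_nat_def)
  next
    case (add f g)
    then show ?case by (metis eval_cpoly_add)
  next
    case (mult f g)
    then show ?case by (metis eval_cpoly_mult)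
  qed
  then show ?thesis using that by blast
qed

section \<open>Algebraic sets as zero sets of polynomial functions\<close>

lemma algebraic_set_iff:
  "algebraic_set V \<longleftrightarrow> (\<exists>S \<subseteq> polyfun UNIV. V = {z. \<forall>f\<in>S. f z = 0})"
proof
  assume "algebraic_set V"
  then obtain S :: "'a cpoly set" where S: "V = {z. \<forall>f\<in>S. eval_cpoly f z = 0}"
    unfolding algebraic_set_def by blast
  show "\<exists>S \<subseteq> polyfun UNIV. V = {z. \<forall>f\<in>S. f z = 0}"
    by (rule exI[of _ "eval_cpoly ` S"]) (auto simp: S eval_cpoly_polyfun)
next
  assume "\<exists>S \<subseteq> polyfun UNIV. V = {z. \<forall>f\<in>S. f z = 0}"
  then obtain S where S: "S \<subseteq> polyfun UNIV" "V = {z. \<forall>f\<in>S. f z = 0}" by blast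
  have "\<forall>f\<in>S. \<exists>g :: 'a cpoly. \<forall>z. f z = eval_cpoly g z"
    using S(1) by (meson polyfun_eval_cpoly subsetD)
  \<comment> \<open>All polynomials vanishing on \<open>V\<close> serve as equations, so no
    representative has to be fixed for each member of \<open>S\<close>.\<close>
  then have "V = {z. \<forall>g\<in>{g :: 'a cpoly. \<forall>z\<in>V. eval_cpoly g z = 0}. eval_cpoly g z = 0}"
    unfolding S(2) by (auto) metis
  then show "algebraic_set V" unfolding algebraic_set_def by blast
qed

text \<open>The defining equations are among the polynomials vanishing on \<open>W\<close>. In this
  form a point outside \<open>W\<close> yields a polynomial separating it from
  \<open>W\<close>.\<close>

lemma algebraic_set_vanishing:
  assumes "algebraic_set W"
  shows "z \<in> W \<longleftrightarrow> (\<forall>f\<in>polyfun UNIV. (\<forall>w\<in>W. f w = 0) \<longrightarrow> f z = 0)"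
  using assms unfolding algebraic_set_iff by blast

lemma closed_algebraic_set: "algebraic_set V \<Longrightarrow> closed V"
proof -
  assume "algebraic_set V"
  then obtain S where S: "S \<subseteq> polyfun UNIV" "V = {z. \<forall>f\<in>S. f z = 0}"
    unfolding algebraic_set_iff by blast
  have "V = (\<Inter>f\<in>S. {z. f z = 0})" using S by auto
  moreover have "closed {z. f z = 0}" if "f \<in> S" for f
    using that S(1) by (intro closed_Collect_eq continuous_on_const continuous_on_polyfun[of _ UNIV]) auto
  ultimately show "closed V" by auto
qed

lemma algebraic_set_Int_zeros:
  assumes "algebraic_set W" "F \<subseteq> polyfun UNIV"
  shows "algebraic_set {z\<in>W. \<forall>f\<in>F. f z = 0}"
proof -
  obtain S where "S \<subseteq> polyfun UNIV" "W = {z. \<forall>f\<in>S. f z = 0}"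
    using assms(1) unfolding algebraic_set_iff by blast
  then show ?thesis
    unfolding algebraic_set_iff using assms(2) by (intro exI[of _ "S \<union> F"]) auto
qed

lemma algebraic_set_vimage:
  assumes "algebraic_set V" "\<And>i. (\<lambda>z. h z $ i) \<in> polyfun UNIV"
  shows "algebraic_set (h -` V)"
proof -
  obtain S where S: "S \<subseteq> polyfun UNIV" "V = {z. \<forall>f\<in>S. f z = 0}"
    using assms(1) unfolding algebraic_set_iff by blast
  show ?thesis
    unfolding algebraic_set_iff
    by (rule exI[of _ "(\<lambda>f z. f (h z)) ` S"])
      (use S assms(2) polyfun_compose[of _ UNIV h UNIV] in auto)
qed

section \<open>The descending chain condition for algebraic sets\<close>

text \<open>A monotone subsequence exists; if it decreases, it is constant from the index of its
  least value on.\<close>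

lemma nat_seq_incseq_subseq:
  fixes g :: "nat \<Rightarrow> nat"
  obtains r where "strict_mono r" "incseq (g \<circ> r)"
proof -
  obtain r where r: "strict_mono r" "monoseq (\<lambda>n. g (r n))"
    using seq_monosub[of g] by blast
  show ?thesis
  proof (cases "incseq (\<lambda>n. g (r n))")
    case True
    then show ?thesis using that r by (auto simp: o_def)
  next
    case False
    then have dec: "decseq (\<lambda>n. g (r n))" using r(2) by (simp add: monoseq_iff)
    obtain k where k: "\<And>j. g (r k) \<le> g (r j)"
      using ex_has_least_nat[of "\<lambda>_. True" 0 "\<lambda>n. g (r n)"] by auto
    have "g (r (k + i)) = g (r k)" for i
      using k[of "k + i"] decseqD[OF dec, of k "k + i"] by simp
    then have "incseq (g \<circ> (\<lambda>i. r (k + i)))"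
      by (simp add: incseq_def)
    moreover have "strict_mono (\<lambda>i. r (k + i))"
      using r(1) by (auto simp: strict_mono_def)
    ultimately show ?thesis using that by blast
  qed
qed

text \<open>Subsequences are refined one variable at a time until every exponent is nondecreasing
  along the sequence; its first two members then serve.\<close>

lemma Dickson:
  fixes s :: "nat \<Rightarrow> ('n::finite \<Rightarrow>\<^sub>0 nat)"
  obtains i j where "i < j" "\<And>x. Poly_Mapping.lookup (s i) x \<le> Poly_Mapping.lookup (s j) x"
proof -
  have "\<exists>r. strict_mono r \<and> (\<forall>x\<in>T. incseq (\<lambda>i. Poly_Mapping.lookup (s (r i)) x))"
    if "finite T" for T :: "'n set"
    using that
  proof induction
    case empty
    show ?case by (rule exI[of _ id]) (auto simp: strict_mono_def)
  next
    case (insert x T)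
    then obtain r where r: "strict_mono r" "\<forall>y\<in>T. incseq (\<lambda>i. Poly_Mapping.lookup (s (r i)) y)"
      by blast
    obtain q where q: "strict_mono q" "incseq ((\<lambda>i. Poly_Mapping.lookup (s (r i)) x) \<circ> q)"
      by (rule nat_seq_incseq_subseq)
    have "strict_mono (r \<circ> q)" using r(1) q(1) by (simp add: strict_mono_o)
    moreover have "incseq (\<lambda>i. Poly_Mapping.lookup (s ((r \<circ> q) i)) y)" if "y \<in> insert x T" for y
    proof (cases "y = x")
      case False
      then have "y \<in> T" using that by simp
      then have "incseq (\<lambda>i. Poly_Mapping.lookup (s (r i)) y)" using r(2) by blast
      then show ?thesis
        using strict_mono_less_eq[OF q(1)] by (simp add: incseq_def)
    qed (use q(2) in \<open>simp add: o_def\<close>)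
    ultimately show ?case by blast
  qed
  from this[of UNIV] obtain r where r: "strict_mono r"
    "\<And>x. incseq (\<lambda>i. Poly_Mapping.lookup (s (r i)) x)" by auto
  have "r 0 < r 1" using r(1) by (simp add: strict_mono_def)
  moreover have "Poly_Mapping.lookup (s (r 0)) x \<le> Poly_Mapping.lookup (s (r 1)) x" for x
    using incseqD[OF r(2)[of x], of 0 1] by simp
  ultimately show ?thesis using that by blast
qed

text \<open>The order on exponents is lexicographic, so the comparison is decided at the first
  nonzero entry of \<open>u\<close>.\<close>

lemma zero_le_exponent: "(0 :: 'n::{finite,linorder} \<Rightarrow>\<^sub>0 nat) \<le> u"
proof (cases "u = 0")
  case False
  then have ne: "{k. Poly_Mapping.lookup u k \<noteq> 0} \<noteq> {}"
    using poly_mapping_eqI[of u 0] by force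
  define k where "k = Min {k. Poly_Mapping.lookup u k \<noteq> 0}"
  have "k \<in> {k. Poly_Mapping.lookup u k \<noteq> 0}"
    unfolding k_def by (rule Min_in) (use ne in auto)
  moreover have "Poly_Mapping.lookup u k' = 0" if "k' < k" for k'
    by (metis (mono_tags) Min_le finite k_def leD mem_Collect_eq that)
  ultimately have "0 < u"
    unfolding less_poly_mapping.rep_eq less_fun_def by auto
  then show ?thesis by simp
qed simp

lemma exponent_decomp:
  fixes a b :: "'n::finite \<Rightarrow>\<^sub>0 nat"
  assumes "\<And>x. Poly_Mapping.lookup a x \<le> Poly_Mapping.lookup b x"
  shows "b = (b - a) + a"
  by (rule poly_mapping_eqI) (simp add: lookup_add lookup_minus assms)

text \<open>In an infinite descent Dickson's lemma finds \<open>i < j\<close> with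
  \<open>s j\<close> equal to \<open>s i\<close> plus an exponent. The order is compatible with
  addition and has least element 0, so \<open>s i \<le> s j\<close>, a contradiction.\<close>

lemma wf_exponents: "wf {(a :: 'n::{finite,linorder} \<Rightarrow>\<^sub>0 nat, b). a < b}"
  unfolding wf_iff_no_infinite_down_chain
proof
  assume "\<exists>s. \<forall>i. (s (Suc i), s i) \<in> {(a :: 'n \<Rightarrow>\<^sub>0 nat, b). a < b}"
  then obtain s :: "nat \<Rightarrow> ('n \<Rightarrow>\<^sub>0 nat)" where s: "\<And>i. s (Suc i) < s i" by auto
  obtain i j where ij: "i < j" "\<And>x. Poly_Mapping.lookup (s i) x \<le> Poly_Mapping.lookup (s j) x"
    using Dickson[of s] by blast
  have "s i = 0 + s i" by simp
  also have "\<dots> \<le> (s j - s i) + s i"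
    by (intro add_right_mono zero_le_exponent)
  also have "\<dots> = s j" using exponent_decomp[OF ij(2)] by simp
  finally have "s i \<le> s j" .
  moreover have "s j < s i" using ij(1) s
    by (induction rule: strict_inc_induct) (auto intro: less_trans)
  ultimately show False by simp
qed

lemma lookup_monomial_mult:
  fixes f :: "'n::{finite,linorder} cpoly"
  shows "Poly_Mapping.lookup (Poly_Mapping.single u c * f) (u + k) = c * Poly_Mapping.lookup f k"
proof -
  have "Poly_Mapping.single u c * f = (\<Sum>b\<in>Poly_Mapping.keys f.
      Poly_Mapping.single (u + b) (c * Poly_Mapping.lookup f b))"
    by (subst cpoly_sum_monomials[of f]) (simp add: sum_distrib_left mult_single)
  then have "Poly_Mapping.lookup (Poly_Mapping.single u c * f) (u + k)
      = (\<Sum>b\<in>Poly_Mapping.keys f. if b = k then c * Poly_Mapping.lookup f b else 0)"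
    by (auto simp: lookup_sum lookup_single when_def intro!: sum.cong)
  also have "\<dots> = c * Poly_Mapping.lookup f k"
    by (auto simp: in_keys_iff)
  finally show ?thesis .
qed

lemma keys_monomial_mult:
  fixes f :: "'n::{finite,linorder} cpoly"
  shows "Poly_Mapping.keys (Poly_Mapping.single u c * f) \<subseteq> (+) u ` Poly_Mapping.keys f"
  using keys_mult[of "Poly_Mapping.single u c" f] by (auto split: if_splits)

text \<open>At the zero polynomial this is \<open>Max\<close> of an empty set; the chain argument
  selects only polynomials from \<open>I (Suc k) - I k\<close>, which are nonzero.\<close>

definition leading_exponent :: "'n::{finite,linorder} cpoly \<Rightarrow> ('n \<Rightarrow>\<^sub>0 nat)" where
  "leading_exponent f = Max (Poly_Mapping.keys f)"

text \<open>
  In a strictly descending chain pick, at each step, a polynomial of minimal leading exponent that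
  vanishes on the new set but not on the old one; by Dickson's lemma the leading term of a later
  one could be cancelled by an earlier one.
\<close>

lemma no_infinite_algebraic_chain:
  fixes W :: "nat \<Rightarrow> (complex ^ 'n::{finite,linorder}) set"
  assumes alg: "\<And>k. algebraic_set (W k)" and chain: "\<And>k. W (Suc k) \<subset> W k"
  shows False
proof -
  define I where "I k = {f :: 'n cpoly. \<forall>z\<in>W k. eval_cpoly f z = 0}" for k
  have anti: "W j \<subseteq> W i" if "i \<le> j" for i j
    using that chain by (induction rule: dec_induct) auto
  then have mono: "I i \<subseteq> I j" if "i \<le> j" for i j
    using that unfolding I_def by blast
  have "\<exists>f. f \<in> I (Suc k) - I k \<and> (\<forall>g\<in>I (Suc k) - I k. \<not> leading_exponent g < leading_exponent f)" for k
  proof -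
    obtain z where z: "z \<in> W k" "z \<notin> W (Suc k)" using chain[of k] by blast
    obtain h where h: "h \<in> polyfun UNIV" "\<forall>w\<in>W (Suc k). h w = 0" "h z \<noteq> 0"
      using z(2) algebraic_set_vanishing[OF alg[of "Suc k"]] by blast
    obtain h' :: "'n cpoly" where "\<And>z. h z = eval_cpoly h' z"
      using polyfun_eval_cpoly[OF h(1)] by blast
    then have "h' \<in> I (Suc k) - I k" using h z unfolding I_def by auto
    then have "leading_exponent h' \<in> leading_exponent ` (I (Suc k) - I k)" by blast
    from wfE_min[OF wf_exponents this] obtain e where
      e: "e \<in> leading_exponent ` (I (Suc k) - I k)"
        "\<And>y. (y, e) \<in> {(a, b). a < b} \<Longrightarrow> y \<notin> leading_exponent ` (I (Suc k) - I k)"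
      by metis
    then obtain f where "f \<in> I (Suc k) - I k" "e = leading_exponent f" by blast
    then show ?thesis using e(2) by (intro exI[of _ f]) blast
  qed
  then obtain f where f: "\<And>k. f k \<in> I (Suc k) - I k"
    and fmin: "\<And>k g. g \<in> I (Suc k) - I k \<Longrightarrow> \<not> leading_exponent g < leading_exponent (f k)"
    by metis
  have f0: "f k \<noteq> 0" for k
    using f[of k] unfolding I_def by auto
  have lead: "leading_exponent g \<in> Poly_Mapping.keys g" if "g \<noteq> 0" for g :: "'n cpoly"
    unfolding leading_exponent_def by (rule Max_in) (use that in auto)
  have le_lead: "a \<le> leading_exponent g" if "a \<in> Poly_Mapping.keys g" for a and g :: "'n cpoly"
    unfolding leading_exponent_def by (rule Max_ge) (use that in auto)
  obtain i j where ij: "i < j" "\<And>x. Poly_Mapping.lookup (leading_exponent (f i)) x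
      \<le> Poly_Mapping.lookup (leading_exponent (f j)) x"
    using Dickson[of "\<lambda>k. leading_exponent (f k)"] by blast
  define u where "u = leading_exponent (f j) - leading_exponent (f i)"
  have u: "leading_exponent (f j) = u + leading_exponent (f i)"
    unfolding u_def by (rule exponent_decomp[OF ij(2)])
  define c where "c = Poly_Mapping.lookup (f j) (leading_exponent (f j))
      / Poly_Mapping.lookup (f i) (leading_exponent (f i))"
  define g where "g = f j + Poly_Mapping.single u (- c) * f i"
  have ev: "eval_cpoly g z = eval_cpoly (f j) z - c * monom_val u z * eval_cpoly (f i) z" for z
    unfolding g_def by (simp add: eval_cpoly_add eval_cpoly_mult eval_cpoly_single)
  \<comment> \<open>Since \<open>f i\<close> vanishes on \<open>W (Suc i)\<close>, which contains
    \<open>W j\<close>, the functions \<open>g\<close> and \<open>f j\<close> agree on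
    \<open>W j\<close>; hence \<open>g\<close> competes with \<open>f j\<close> for the least
    leading exponent.\<close>
  have "f i \<in> I j" using f[of i] mono[of "Suc i" j] ij(1) by auto
  then have van: "eval_cpoly (f i) z = 0" if "z \<in> W j" for z
    using that unfolding I_def by blast
  have "g \<in> I (Suc j)"
    using f[of j] van chain[of j] unfolding I_def by (auto simp: ev)
  moreover have "g \<notin> I j"
    using f[of j] van unfolding I_def by (auto simp: ev)
  ultimately have g: "g \<in> I (Suc j) - I j" by blast
  then have "g \<noteq> 0" unfolding I_def by auto
  have "Poly_Mapping.lookup (f i) (leading_exponent (f i)) \<noteq> 0"
    using lead[OF f0[of i]] by (simp add: in_keys_iff)
  then have "Poly_Mapping.lookup g (leading_exponent (f j)) = 0"
    unfolding g_def lookup_add by (subst (2) u) (simp add: lookup_monomial_mult c_def)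
  then have ne: "leading_exponent g \<noteq> leading_exponent (f j)"
    using lead[OF \<open>g \<noteq> 0\<close>] by (auto simp: in_keys_iff)
  have "leading_exponent g \<in> Poly_Mapping.keys (f j) \<union> (+) u ` Poly_Mapping.keys (f i)"
    using lead[OF \<open>g \<noteq> 0\<close>] keys_add[of "f j" "Poly_Mapping.single u (- c) * f i"]
      keys_monomial_mult[of u "- c" "f i"] unfolding g_def by auto
  then have "leading_exponent g \<le> leading_exponent (f j)"
  proof
    assume "leading_exponent g \<in> (+) u ` Poly_Mapping.keys (f i)"
    then show ?thesis unfolding u using le_lead[of _ "f i"] by (auto intro: add_left_mono)
  qed (rule le_lead)
  with ne fmin[OF g] show False by simp
qed

text \<open>Noetherian induction: the descending chain condition makes proper inclusion of algebraic
  sets well founded.\<close>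

lemma algebraic_set_induct [consumes 1, case_names less]:
  fixes W :: "(complex ^ 'n::{finite,linorder}) set"
  assumes "algebraic_set W"
    and "\<And>W. algebraic_set W \<Longrightarrow> (\<And>W'. algebraic_set W' \<Longrightarrow> W' \<subset> W \<Longrightarrow> P W') \<Longrightarrow> P W"
  shows "P W"
proof -
  have wf: "wf {(A, B). algebraic_set A \<and> algebraic_set B \<and> A \<subset> (B :: (complex, 'n) vec set)}"
    unfolding wf_iff_no_infinite_down_chain proof
    assume "\<exists>f. \<forall>i. (f (Suc i), f i) \<in> {(A, B). algebraic_set A \<and> algebraic_set B \<and> A \<subset> (B :: (complex, 'n) vec set)}"
    then obtain f :: "nat \<Rightarrow> (complex, 'n) vec set"
      where "\<And>i. algebraic_set (f (Suc i)) \<and> algebraic_set (f i) \<and> f (Suc i) \<subset> f i" by auto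
    then show False using no_infinite_algebraic_chain[of f] by blast
  qed
  show ?thesis using assms(1)
  proof (induction W rule: wf_induct_rule[OF wf])
    case (1 W)
    show ?case by (rule assms(2)[OF 1(2)]) (use 1 in blast)
  qed
qed

section \<open>Generic points of irreducible algebraic sets\<close>

text \<open>Quantitative continuity of roots: if every root had distance at least \<open>e\<close>
  from \<open>w\<close>, the factorisation into linear factors would give
  \<open>cmod (poly p w) \<ge> cmod (coeff p N) * e ^ N\<close>.\<close>

lemma root_near:
  fixes p :: "complex poly"
  assumes "degree p \<le> N" "N \<ge> 1" "coeff p N \<noteq> 0" "e > 0"
    and small: "cmod (poly p w) < cmod (coeff p N) * e ^ N"
  shows "\<exists>r. poly p r = 0 \<and> cmod (r - w) < e"
proof (rule ccontr)
  assume no: "\<not> ?thesis"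
  have deg: "degree p = N" using assms by (simp add: le_antisym le_degree)
  then have p0: "p \<noteq> 0" using assms(3) by auto
  have far: "e \<le> cmod (w - x)" if "x \<in># proots p" for x
    using that no p0 by (auto simp: norm_minus_commute not_less)
  have "e ^ size X \<le> cmod (poly (\<Prod>x\<in>#X. [:- x, 1:]) w)"
    if "\<And>x. x \<in># X \<Longrightarrow> e \<le> cmod (w - x)" for X
    using that
  proof (induction X)
    case (add x X)
    then have "e * e ^ size X \<le> cmod (w - x) * cmod (poly (\<Prod>x\<in>#X. [:- x, 1:]) w)"
      by (intro mult_mono) (use \<open>e > 0\<close> in auto)
    then show ?case by (simp add: algebra_simps flip: norm_mult)
  qed simp
  from this[of "proots p"] far
  have "e ^ N \<le> cmod (poly (\<Prod>x\<in>#proots p. [:- x, 1:]) w)"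
    by (simp add: size_proots_complex deg)
  then have "cmod (coeff p N) * e ^ N \<le> cmod (coeff p N) * \<dots>"
    by (intro mult_left_mono) auto
  also have "\<dots> = cmod (poly (smult (lead_coeff p) (\<Prod>x\<in>#proots p. [:- x, 1:])) w)"
    by (simp add: norm_mult deg)
  also have "\<dots> = cmod (poly p w)"
    by (simp only: complex_poly_decompose_multiset)
  finally show False using small by simp
qed

text \<open>A polynomial in one further variable whose coefficients are polynomial functions of the
  coordinates in \<open>B\<close>. \<open>N\<close> is only a uniform bound: the degree may drop at
  particular points.\<close>

definition poly_over :: "'n::finite set \<Rightarrow> nat \<Rightarrow> (complex ^ 'n \<Rightarrow> complex poly) \<Rightarrow> bool" where
  "poly_over B N p \<longleftrightarrow> (\<forall>j. (\<lambda>z. coeff (p z) j) \<in> polyfun B) \<and> (\<forall>z. degree (p z) \<le> N)"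

lemma poly_overD:
  assumes "poly_over B N p"
  shows "(\<lambda>z. coeff (p z) j) \<in> polyfun B" "degree (p z) \<le> N"
  using assms unfolding poly_over_def by auto

lemma poly_over_eval:
  assumes "poly_over B N p"
  shows "poly (p z) w = (\<Sum>j\<le>N. coeff (p z) j * w ^ j)"
  unfolding poly_altdef
  by (rule sum.mono_neutral_left) (use poly_overD(2)[OF assms, of z] in \<open>auto intro: coeff_eq_0\<close>)

lemma poly_over_polyfun:
  assumes "poly_over B N p" "g \<in> polyfun B"
  shows "(\<lambda>z. poly (p z) (g z)) \<in> polyfun B"
  unfolding poly_over_eval[OF assms(1)]
  by (intro polyfun_intros poly_overD(1)[OF assms(1)] assms(2))

lemma poly_over_mono: "poly_over B N p \<Longrightarrow> B \<subseteq> C \<Longrightarrow> N \<le> M \<Longrightarrow> poly_over C M p"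
  unfolding poly_over_def by (meson order_trans polyfun_mono)

lemma poly_over_mult:
  assumes "poly_over B N p" "poly_over B M q"
  shows "poly_over B (N + M) (\<lambda>z. p z * q z)"
  unfolding poly_over_def
proof (intro conjI allI)
  show "(\<lambda>z. coeff (p z * q z) j) \<in> polyfun B" for j
    unfolding coeff_mult using assms by (intro polyfun_intros) (auto dest: poly_overD(1))
  show "degree (p z * q z) \<le> N + M" for z
    by (rule order_trans[OF degree_mult_le add_mono]) (use assms in \<open>auto dest: poly_overD(2)\<close>)
qed

lemma poly_over_add:
  assumes "poly_over B N p" "poly_over B N q"
  shows "poly_over B N (\<lambda>z. p z + q z)"
  using assms unfolding poly_over_def by (auto intro: polyfun_intros degree_add_le)

lemma polyfun_insert_poly_over:
  assumes "f \<in> polyfun (insert x T)"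
  obtains p N where "poly_over T N p" "\<And>z. f z = poly (p z) (z $ x)"
proof -
  have "\<exists>p N. poly_over T N p \<and> (\<forall>z. f z = poly (p z) (z $ x))"
    using assms
  proof (induction rule: polyfun.induct)
    case (const c)
    show ?case
      by (rule exI[of _ "\<lambda>z. [:c:]"], rule exI[of _ 0])
        (auto simp: poly_over_def coeff_pCons split: nat.splits intro: polyfun.intros)
  next
    case (coord i)
    show ?case
    proof (cases "i = x")
      case True
      then show ?thesis
        by (intro exI[of _ "\<lambda>z. [:0, 1:]"] exI[of _ 1])
          (auto simp: poly_over_def intro: polyfun.intros)
    next
      case False
      have "(\<lambda>z. coeff [:z $ i:] j) \<in> polyfun T" for j
        using coord False by (cases j) (auto intro: polyfun.intros)
      then show ?thesis
        by (intro exI[of _ "\<lambda>z. [:z $ i:]"] exI[of _ 0]) (auto simp: poly_over_def)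
    qed
  next
    case (add f g)
    then obtain p q N M where "poly_over T N p" "\<forall>z. f z = poly (p z) (z $ x)"
      "poly_over T M q" "\<forall>z. g z = poly (q z) (z $ x)" by blast
    then show ?case
      using poly_over_mono[of T N p T "max N M"] poly_over_mono[of T M q T "max N M"]
      by (intro exI[of _ "\<lambda>z. p z + q z"] exI[of _ "max N M"]) (auto intro: poly_over_add)
  next
    case (mult f g)
    then obtain p q N M where "poly_over T N p" "\<forall>z. f z = poly (p z) (z $ x)"
      "poly_over T M q" "\<forall>z. g z = poly (q z) (z $ x)" by blast
    then show ?case
      by (intro exI[of _ "\<lambda>z. p z * q z"] exI[of _ "N + M"]) (auto intro: poly_over_mult)
  qed
  then show ?thesis using that by blast
qed

text \<open>Algebraic independence of the coordinates in \<open>T\<close> modulo the polynomials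
  that vanish on \<open>W\<close>.\<close>

definition independent_on :: "(complex ^ 'n::finite) set \<Rightarrow> 'n set \<Rightarrow> bool" where
  "independent_on W T \<longleftrightarrow> (\<forall>f\<in>polyfun T. (\<forall>z\<in>W. f z = 0) \<longrightarrow> (\<forall>z. f z = 0))"

lemma independent_onD:
  assumes "independent_on W T" "f \<in> polyfun T" "\<And>z. z \<in> W \<Longrightarrow> f z = 0"
  shows "f y = 0"
  using assms unfolding independent_on_def by blast

lemma open_coordinate_box:
  fixes U :: "(complex ^ 'n::finite) set"
  assumes "open U" "a \<in> U"
  obtains e where "e > 0" "\<And>z. (\<And>i. cmod (z $ i - a $ i) < e) \<Longrightarrow> z \<in> U"
proof -
  obtain d where d: "d > 0" "ball a d \<subseteq> U" using assms open_contains_ball by blast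
  show ?thesis
  proof
    show "d / real CARD('n) > 0" using d by simp
    fix z :: "complex ^ 'n"
    assume *: "\<And>i. cmod (z $ i - a $ i) < d / real CARD('n)"
    have "norm (z - a) \<le> (\<Sum>i\<in>UNIV. cmod ((z - a) $ i))"
      unfolding norm_vec_def by (rule L2_set_le_sum) auto
    also have "\<dots> < (\<Sum>i\<in>(UNIV :: 'n set). d / real CARD('n))"
      by (rule sum_strict_mono) (use * in auto)
    also have "\<dots> = d" by simp
    finally show "z \<in> U" using d(2) by (auto simp: dist_norm norm_minus_commute)
  qed
qed

text \<open>Coefficients above the last one that is not identically zero on \<open>W\<close> are cut
  off. Nothing changes on \<open>W\<close>, and the formal leading coefficient becomes nonzero
  somewhere on \<open>W\<close>.\<close>

lemma lead_truncate:
  assumes p: "poly_over B N p" and van: "\<forall>z\<in>W. poly (p z) (z $ x) = 0"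
    and nz: "z0 \<in> W" "coeff (p z0) j \<noteq> 0"
  obtains q M where "M \<le> N" "poly_over B M q" "\<forall>z\<in>W. poly (q z) (z $ x) = 0"
    "\<exists>z\<in>W. coeff (q z) M \<noteq> 0"
proof -
  define M where "M = Max {j. j \<le> N \<and> (\<exists>z\<in>W. coeff (p z) j \<noteq> 0)}"
  have jN: "j \<le> N" using nz(2) poly_overD(2)[OF p, of z0] le_degree order_trans by blast
  have "M \<in> {j. j \<le> N \<and> (\<exists>z\<in>W. coeff (p z) j \<noteq> 0)}"
    unfolding M_def by (rule Max_in) (use nz jN in auto)
  then have M: "M \<le> N" "\<exists>z\<in>W. coeff (p z) M \<noteq> 0" by auto
  have high: "coeff (p z) k = 0" if "z \<in> W" "M < k" for z k
  proof (rule ccontr)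
    assume "coeff (p z) k \<noteq> 0"
    moreover then have "k \<le> N" using poly_overD(2)[OF p, of z] le_degree order_trans by blast
    ultimately have "k \<le> M" unfolding M_def using that(1) by (intro Max_ge) auto
    then show False using that(2) by simp
  qed
  define q where "q z = (\<Sum>k\<le>M. monom (coeff (p z) k) k)" for z
  have cq: "coeff (q z) k = (if k \<le> M then coeff (p z) k else 0)" for z k
    unfolding q_def coeff_sum coeff_monom by (simp add: if_distrib cong: if_cong)
  have "q z = p z" if "z \<in> W" for z
    by (rule poly_eqI) (use high[OF that] in \<open>auto simp: cq\<close>)
  moreover have "poly_over B M q"
    unfolding poly_over_def
  proof (intro conjI allI)
    show "(\<lambda>z. coeff (q z) k) \<in> polyfun B" for k
      unfolding cq using poly_overD(1)[OF p] by (cases "k \<le> M") (auto intro: polyfun.intros)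
    show "degree (q z) \<le> M" for z by (rule degree_le) (auto simp: cq)
  qed
  ultimately show ?thesis using that[of M q] M van by (simp add: cq)
qed

text \<open>
  Elimination of one coordinate: \<open>M\<close> has the least degree among the relations for \<open>z $ x\<close> over
  \<open>B\<close> that hold on \<open>W\<close>, so pseudo-division by \<open>M\<close> reduces every other relation to relations
  over \<open>B\<close>, as long as the leading coefficient of \<open>M\<close> does not vanish.
\<close>

lemma pseudo_division_relation:
  assumes M: "poly_over B N M" "\<forall>z\<in>W. poly (M z) (z $ x) = 0" "N \<ge> 1"
    and least: "\<And>K d. K < N \<Longrightarrow> poly_over B K d \<Longrightarrow> \<forall>z\<in>W. poly (d z) (z $ x) = 0 \<Longrightarrow>
      \<forall>z\<in>W. coeff (d z) K = 0"
    and y: "\<And>g. g \<in> polyfun B \<Longrightarrow> \<forall>z\<in>W. g z = 0 \<Longrightarrow> g y = 0"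
      "coeff (M y) N \<noteq> 0" "poly (M y) (y $ x) = 0"
    and d: "poly_over B K d" "\<forall>z\<in>W. poly (d z) (z $ x) = 0"
  shows "poly (d y) (y $ x) = 0"
  using d
proof (induction K arbitrary: d rule: less_induct)
  case (less K)
  note d = less.prems
  show ?case
  proof (cases "K < N")
    case True
    \<comment> \<open>A coefficient that is nonzero somewhere on \<open>W\<close> would, after
      truncation, give a relation of formal degree below \<open>N\<close> with nonvanishing leading
      coefficient, against \<open>least\<close>.\<close>
    have "coeff (d z) j = 0" if zW: "z \<in> W" for z j
    proof (rule ccontr)
      assume nz: "coeff (d z) j \<noteq> 0"
      obtain q K' where "K' \<le> K" "poly_over B K' q" "\<forall>z\<in>W. poly (q z) (z $ x) = 0"
        "\<exists>z\<in>W. coeff (q z) K' \<noteq> 0"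
        by (rule lead_truncate[OF d zW nz]) (rule that)
      then show False using least[of K' q] True by auto
    qed
    then have "coeff (d y) j = 0" for j using y(1)[OF poly_overD(1)[OF d(1)]] by blast
    then have "d y = 0" by (intro poly_eqI) simp
    then show ?thesis by simp
  next
    case False
    \<comment> \<open>One pseudo-division step: cross-multiplying by the leading coefficients
      cancels the term of degree \<open>K\<close> without any division.\<close>
    define e where "e z = smult (coeff (M z) N) (d z) - smult (coeff (d z) K) (monom 1 (K - N) * M z)" for z
    have ce: "coeff (e z) j = coeff (M z) N * coeff (d z) j
        - coeff (d z) K * (if K - N \<le> j then coeff (M z) (j - (K - N)) else 0)" for z j
      unfolding e_def by (simp add: coeff_monom_mult)
    have "coeff (e z) j = 0" if "K - 1 < j" for z j
    proof (cases "j = K")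
      case True
      then show ?thesis using False by (simp add: ce)
    next
      case j: False
      then have "K < j" using that by simp
      then have "coeff (d z) j = 0" "coeff (M z) (j - (K - N)) = 0"
        using poly_overD(2)[OF d(1), of z] poly_overD(2)[OF M(1), of z] False
        by (auto intro!: coeff_eq_0)
      then show ?thesis by (simp add: ce)
    qed
    then have dege: "degree (e z) \<le> K - 1" for z by (intro degree_le) auto
    have "(\<lambda>z. if K - N \<le> j then coeff (M z) (j - (K - N)) else 0) \<in> polyfun B" for j
      using poly_overD(1)[OF M(1)] by (cases "K - N \<le> j") (simp_all add: polyfun.const)
    then have polye: "(\<lambda>z. coeff (e z) j) \<in> polyfun B" for j
      unfolding ce
      by (intro polyfun_diff polyfun.mult poly_overD(1)[OF d(1)] poly_overD(1)[OF M(1)])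
    have ee: "poly (e z) (z $ x) = coeff (M z) N * poly (d z) (z $ x)
        - coeff (d z) K * ((z $ x) ^ (K - N) * poly (M z) (z $ x))" for z
      unfolding e_def by (simp add: poly_monom)
    have "poly (e y) (y $ x) = 0"
    proof (rule less.IH)
      show "K - 1 < K" using False M(3) by simp
      show "poly_over B (K - 1) e" unfolding poly_over_def using dege polye by blast
      show "\<forall>z\<in>W. poly (e z) (z $ x) = 0" using d(2) M(2) by (simp add: ee)
    qed
    then show ?thesis using y by (simp add: ee)
  qed
qed

text \<open>Every \<open>t\<close> close to \<open>a\<close> on \<open>T\<close> has a lift
  \<open>z\<close> close to \<open>a\<close> on \<open>X\<close> that satisfies all relations of
  \<open>W\<close> in the coordinates \<open>T \<union> X\<close>. When these are all coordinates
  and \<open>W\<close> is algebraic, the last condition says \<open>z \<in> W\<close>. The remaining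
  coordinates stay at \<open>a\<close>, which lets \<open>X\<close> grow one coordinate at a
  time.\<close>

definition lifts_near :: "(complex ^ 'n::finite) set \<Rightarrow> 'n set \<Rightarrow> 'n set \<Rightarrow> complex ^ 'n \<Rightarrow> bool" where
  "lifts_near W T X a \<longleftrightarrow> (\<forall>e>0. \<exists>d>0. \<forall>t. (\<forall>i\<in>T. cmod (t $ i - a $ i) < d) \<longrightarrow>
    (\<exists>z. (\<forall>i\<in>T. z $ i = t $ i) \<and> (\<forall>i\<in>X. cmod (z $ i - a $ i) < e) \<and>
      (\<forall>i. i \<notin> T \<union> X \<longrightarrow> z $ i = a $ i) \<and>
      (\<forall>f\<in>polyfun (T \<union> X). (\<forall>w\<in>W. f w = 0) \<longrightarrow> f z = 0)))"

text \<open>The dependent coordinates are adjoined one by one. A new \<open>x\<close> satisfies a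
  relation \<open>M\<close> of least degree over the previous coordinates; where its leading
  coefficient \<open>c\<close> is nonzero, \<open>root_near\<close> supplies a value for
  \<open>x\<close>, and \<open>pseudo_division_relation\<close> shows that all other relations
  follow. The function \<open>l\<close> collects the leading coefficients, and primality keeps the
  product from vanishing identically on \<open>W\<close>.\<close>

lemma triangular_lift:
  fixes W :: "(complex ^ 'n::finite) set" and T X :: "'n set"
  assumes prime: "\<And>f g. f \<in> polyfun UNIV \<Longrightarrow> g \<in> polyfun UNIV \<Longrightarrow> \<forall>z\<in>W. f z * g z = 0 \<Longrightarrow>
      (\<forall>z\<in>W. f z = 0) \<or> (\<forall>z\<in>W. g z = 0)"
    and "W \<noteq> {}" and indep: "independent_on W T"
    and "X \<inter> T = {}" and "\<forall>x\<in>X. \<not> independent_on W (insert x T)"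
  shows "\<exists>l\<in>polyfun (T \<union> X). (\<exists>z\<in>W. l z \<noteq> 0) \<and>
    (\<forall>a\<in>W. l a \<noteq> 0 \<longrightarrow> lifts_near W T X a)"
proof -
  have "finite X" by simp
  then show ?thesis using assms(4,5)
  proof (induction X)
    case empty
    show ?case
    proof (rule bexI[of _ "\<lambda>_. 1"], intro conjI ballI impI allI)
      fix a
      \<comment> \<open>Independence leaves only trivial relations in the coordinates
        \<open>T\<close>, so any \<open>t\<close>, completed by \<open>a\<close>, is a lift.\<close>
      have "\<exists>z. (\<forall>i\<in>T. z $ i = t $ i) \<and> (\<forall>i. i \<notin> T \<longrightarrow> z $ i = a $ i) \<and>
        (\<forall>f\<in>polyfun T. (\<forall>w\<in>W. f w = 0) \<longrightarrow> f z = 0)" for t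
        by (rule exI[of _ "\<chi> i. if i \<in> T then t $ i else a $ i"])
          (use indep in \<open>auto simp: independent_on_def\<close>)
      then show "lifts_near W T {} a" unfolding lifts_near_def by (auto intro!: exI[of _ "1::real"])
    qed (use \<open>W \<noteq> {}\<close> in \<open>auto intro: polyfun.intros\<close>)
  next
    case (insert x X)
    define B where "B = T \<union> X"
    have xB: "x \<notin> B" using insert.hyps insert.prems(1) by (auto simp: B_def)
    have "X \<inter> T = {}" "\<forall>y\<in>X. \<not> independent_on W (insert y T)"
      using insert.prems by auto
    from insert.IH[OF this, folded B_def] obtain l where l: "l \<in> polyfun B" "\<exists>z\<in>W. l z \<noteq> 0"
      and lift: "\<forall>a\<in>W. l a \<noteq> 0 \<longrightarrow> lifts_near W T X a" by blast
    \<comment> \<open>The condition on \<open>coeff (p z) N\<close> excludes relations that hold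
      only because all coefficients vanish on \<open>W\<close>; the least such \<open>N\<close>
      provides the divisor \<open>M\<close>.\<close>
    define P where "P N \<longleftrightarrow> (\<exists>p. poly_over B N p \<and> (\<forall>z\<in>W. poly (p z) (z $ x) = 0) \<and>
      (\<exists>z\<in>W. coeff (p z) N \<noteq> 0))" for N
    have "\<exists>N. P N"
    proof -
      obtain f z0 where f: "f \<in> polyfun (insert x T)" "\<forall>z\<in>W. f z = 0" "f z0 \<noteq> 0"
        using insert.prems(2) unfolding independent_on_def by auto
      obtain p N where p: "poly_over T N p" "\<And>z. f z = poly (p z) (z $ x)"
        using polyfun_insert_poly_over[OF f(1)] by blast
      have "p z0 \<noteq> 0" using f(3) p(2) by auto
      then obtain j where j: "coeff (p z0) j \<noteq> 0" using leading_coeff_0_iff by blast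
      \<comment> \<open>A nonzero coefficient over the independent set \<open>T\<close> cannot
        vanish on all of \<open>W\<close>.\<close>
      obtain z where z: "z \<in> W" "coeff (p z) j \<noteq> 0"
        using independent_onD[OF indep poly_overD(1)[OF p(1), of j], of z0] j by auto
      have van: "\<forall>z\<in>W. poly (p z) (z $ x) = 0" using f(2) p(2) by simp
      obtain q M where "poly_over T M q" "\<forall>z\<in>W. poly (q z) (z $ x) = 0"
        "\<exists>z\<in>W. coeff (q z) M \<noteq> 0"
        by (rule lead_truncate[OF p(1) van z]) (rule that)
      moreover have "poly_over B M q"
        using \<open>poly_over T M q\<close> by (rule poly_over_mono) (auto simp: B_def)
      ultimately show ?thesis unfolding P_def by blast
    qed
    then obtain N where N: "P N" "\<And>K. K < N \<Longrightarrow> \<not> P K"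
      using exists_least_iff[of P] by blast
    then obtain M where M: "poly_over B N M" "\<forall>z\<in>W. poly (M z) (z $ x) = 0"
      "\<exists>z\<in>W. coeff (M z) N \<noteq> 0" unfolding P_def by blast
    have "N \<ge> 1"
    proof (rule ccontr)
      assume "\<not> N \<ge> 1"
      then have "N = 0" by simp
      have "coeff (M z) 0 = 0" if "z \<in> W" for z
        using M(2) that poly_over_eval[OF M(1), of z "z $ x"] unfolding \<open>N = 0\<close> by simp
      then show False using M(3) \<open>N = 0\<close> by auto
    qed
    define c where "c z = coeff (M z) N" for z
    have c: "c \<in> polyfun B" unfolding c_def[abs_def] by (rule poly_overD(1)[OF M(1)])
    have lB: "l \<in> polyfun UNIV" "c \<in> polyfun UNIV" using l(1) c polyfun_mono by blast+
    show ?case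
    proof (rule bexI[of _ "\<lambda>z. l z * c z"], intro conjI ballI impI allI)
      show "\<exists>z\<in>W. l z * c z \<noteq> 0"
        using prime[OF lB] l(2) M(3) unfolding c_def by blast
      have "T \<union> insert x X = insert x B" by (auto simp: B_def)
      then show "(\<lambda>z. l z * c z) \<in> polyfun (T \<union> insert x X)"
        using l(1) c by (auto intro!: polyfun.intros elim: polyfun_mono)
    next
      fix a assume a: "a \<in> W" "l a * c a \<noteq> 0"
      show "lifts_near W T (insert x X) a"
        unfolding lifts_near_def
      proof (intro allI impI)
        fix e :: real assume "e > 0"
        \<comment> \<open>On \<open>U\<close> the hypothesis of \<open>root_near\<close> holds for
          \<open>M z\<close> at \<open>a $ x\<close>. The point \<open>a\<close> belongs to it
          because \<open>a $ x\<close> is a root of \<open>M a\<close> and \<open>c a\<close> is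
          nonzero.\<close>
        define U where "U = {z. cmod (poly (M z) (a $ x)) < cmod (c z) * e ^ N}"
        have "open U" unfolding U_def
          by (intro open_Collect_less continuous_intros continuous_on_polyfun[OF c]
              continuous_on_polyfun[OF poly_over_polyfun[OF M(1)]]) (auto intro: polyfun.intros)
        moreover have "a \<in> U"
          using a M(2) \<open>e > 0\<close> unfolding U_def by simp
        ultimately obtain h where h: "h > 0" "\<And>z. (\<And>i. cmod (z $ i - a $ i) < h) \<Longrightarrow> z \<in> U"
          using open_coordinate_box by blast
        obtain d where d: "d > 0" and dz: "\<And>t. (\<forall>i\<in>T. cmod (t $ i - a $ i) < d) \<Longrightarrow>
          (\<exists>z. (\<forall>i\<in>T. z $ i = t $ i) \<and> (\<forall>i\<in>X. cmod (z $ i - a $ i) < min e h) \<and>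
          (\<forall>i. i \<notin> B \<longrightarrow> z $ i = a $ i) \<and>
          (\<forall>f\<in>polyfun B. (\<forall>w\<in>W. f w = 0) \<longrightarrow> f z = 0))"
        proof -
          have near: "lifts_near W T X a" using lift a by auto
          have "\<exists>d>0. \<forall>t. (\<forall>i\<in>T. cmod (t $ i - a $ i) < d) \<longrightarrow>
            (\<exists>z. (\<forall>i\<in>T. z $ i = t $ i) \<and> (\<forall>i\<in>X. cmod (z $ i - a $ i) < min e h) \<and>
            (\<forall>i. i \<notin> B \<longrightarrow> z $ i = a $ i) \<and>
            (\<forall>f\<in>polyfun B. (\<forall>w\<in>W. f w = 0) \<longrightarrow> f z = 0))"
            unfolding B_def by (rule near[unfolded lifts_near_def, rule_format]) (use \<open>e > 0\<close> h(1) in simp)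
          then show ?thesis by (elim exE conjE) (rule that, assumption, blast)
        qed
        show "\<exists>d>0. \<forall>t. (\<forall>i\<in>T. cmod (t $ i - a $ i) < d) \<longrightarrow>
          (\<exists>z. (\<forall>i\<in>T. z $ i = t $ i) \<and> (\<forall>i\<in>insert x X. cmod (z $ i - a $ i) < e) \<and>
          (\<forall>i. i \<notin> T \<union> insert x X \<longrightarrow> z $ i = a $ i) \<and>
          (\<forall>f\<in>polyfun (T \<union> insert x X). (\<forall>w\<in>W. f w = 0) \<longrightarrow> f z = 0))"
        proof (rule exI[of _ "min d h"], intro conjI allI impI)
          show "min d h > 0" using d h by simp
          fix t :: "complex ^ 'n" assume t: "\<forall>i\<in>T. cmod (t $ i - a $ i) < min d h"
          then have "\<forall>i\<in>T. cmod (t $ i - a $ i) < d" by simp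
          from dz[OF this] obtain z where z: "\<forall>i\<in>T. z $ i = t $ i"
            "\<forall>i\<in>X. cmod (z $ i - a $ i) < min e h" "\<forall>i. i \<notin> B \<longrightarrow> z $ i = a $ i"
            "\<forall>f\<in>polyfun B. (\<forall>w\<in>W. f w = 0) \<longrightarrow> f z = 0"
            by (elim exE conjE) (rule that)
          have "z \<in> U"
          proof (rule h(2))
            fix i show "cmod (z $ i - a $ i) < h"
              by (cases "i \<in> T"; cases "i \<in> X") (use z t h(1) in \<open>auto simp: B_def\<close>)
          qed
          then have "cmod (poly (M z) (a $ x)) < cmod (coeff (M z) N) * e ^ N"
            unfolding U_def c_def by simp
          moreover from this have "coeff (M z) N \<noteq> 0" by auto
          ultimately obtain r where r: "poly (M z) r = 0" "cmod (r - a $ x) < e"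
            using root_near[OF poly_overD(2)[OF M(1)] \<open>N \<ge> 1\<close> _ \<open>e > 0\<close>, of z "a $ x"] by blast
          \<comment> \<open>Only coordinate \<open>x\<close>, which lies outside \<open>B\<close>,
            is replaced by the root, so all functions over \<open>B\<close> keep their
            values.\<close>
          define y where "y = (\<chi> i. if i = x then r else z $ i)"
          have yz: "g y = g z" if "g \<in> polyfun B" for g
            by (rule polyfun_cong[OF that]) (use xB in \<open>auto simp: y_def\<close>)
          have "M y = M z"
            by (rule poly_eqI) (rule yz[OF poly_overD(1)[OF M(1)]])
          have "f y = 0" if f: "f \<in> polyfun (insert x B)" "\<forall>w\<in>W. f w = 0" for f
          proof -
            obtain p K where p: "poly_over B K p" "\<And>z. f z = poly (p z) (z $ x)"
              using polyfun_insert_poly_over[OF f(1)] by blast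
            have "poly (p y) (y $ x) = 0"
            proof (rule pseudo_division_relation[OF M(1,2) \<open>N \<ge> 1\<close>, where y = y and d = p])
              show "\<forall>z\<in>W. coeff (q z) K = 0"
                if "K < N" "poly_over B K q" "\<forall>z\<in>W. poly (q z) (z $ x) = 0" for K q
                using N(2)[of K] that unfolding P_def by blast
              show "g y = 0" if "g \<in> polyfun B" "\<forall>z\<in>W. g z = 0" for g
                using yz[OF that(1)] z(4) that by simp
              show "coeff (M y) N \<noteq> 0" using \<open>M y = M z\<close> \<open>coeff (M z) N \<noteq> 0\<close> by simp
              show "poly (M y) (y $ x) = 0" using \<open>M y = M z\<close> r(1) by (simp add: y_def)
              show "poly_over B K p" by fact
              show "\<forall>z\<in>W. poly (p z) (z $ x) = 0" using f(2) p(2) by simp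
            qed
            then show ?thesis using p(2) by simp
          qed
          moreover have "T \<union> insert x X = insert x B" by (auto simp: B_def)
          moreover have "x \<notin> T" using xB by (simp add: B_def)
          ultimately show "\<exists>z. (\<forall>i\<in>T. z $ i = t $ i) \<and> (\<forall>i\<in>insert x X. cmod (z $ i - a $ i) < e) \<and>
            (\<forall>i. i \<notin> T \<union> insert x X \<longrightarrow> z $ i = a $ i) \<and>
            (\<forall>f\<in>polyfun (T \<union> insert x X). (\<forall>w\<in>W. f w = 0) \<longrightarrow> f z = 0)"
            using z r(2) xB by (intro exI[of _ y]) (auto simp: y_def B_def)
        qed
      qed
    qed
  qed
qed

text \<open>\<open>W\<close> is the union of the zero sets of \<open>f\<close> and \<open>g\<close>
  inside it, and irreducibility makes one of them all of \<open>W\<close>.\<close>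

lemma irreducible_algebraic_set_prime:
  assumes "irreducible_algebraic_set W" "f \<in> polyfun UNIV" "g \<in> polyfun UNIV"
    and "\<forall>z\<in>W. f z * g z = 0"
  shows "(\<forall>z\<in>W. f z = 0) \<or> (\<forall>z\<in>W. g z = 0)"
proof -
  have W: "algebraic_set W" using assms(1) unfolding irreducible_algebraic_set_def by blast
  have "algebraic_set {z\<in>W. f z = 0}" "algebraic_set {z\<in>W. g z = 0}"
    using algebraic_set_Int_zeros[OF W, of "{f}"] algebraic_set_Int_zeros[OF W, of "{g}"] assms
    by auto
  moreover have "W = {z\<in>W. f z = 0} \<union> {z\<in>W. g z = 0}" using assms(4) by auto
  ultimately have "W = {z\<in>W. f z = 0} \<or> W = {z\<in>W. g z = 0}"
    using assms(1) unfolding irreducible_algebraic_set_def by blast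
  then show ?thesis by blast
qed

text \<open>Extending \<open>T0\<close> to a maximal independent \<open>T\<close> makes every other
  coordinate dependent, so \<open>triangular_lift\<close> applies with \<open>X = - T\<close>. The
  lifts then satisfy all equations of \<open>W\<close> and lie in it. \<open>Z\<close> is the part
  of \<open>W\<close> where \<open>l\<close> vanishes.\<close>

lemma generic_projection_open:
  fixes W :: "(complex ^ 'n::finite) set"
  assumes W: "irreducible_algebraic_set W" and T0: "independent_on W T0"
  obtains T Z where "T0 \<subseteq> T" "independent_on W T" "\<And>x. x \<notin> T \<Longrightarrow> \<not> independent_on W (insert x T)"
    "algebraic_set Z" "Z \<subset> W"
    "\<And>a U. a \<in> W - Z \<Longrightarrow> open U \<Longrightarrow> a \<in> U \<Longrightarrow> \<exists>d>0. \<forall>t. (\<forall>i\<in>T. cmod (t $ i - a $ i) < d) \<longrightarrow>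
        (\<exists>z\<in>W \<inter> U. \<forall>i\<in>T. z $ i = t $ i)"
proof -
  have alg: "algebraic_set W" and ne: "W \<noteq> {}"
    using W unfolding irreducible_algebraic_set_def by auto
  have "finite {T. T0 \<subseteq> T \<and> independent_on W T}" "{T. T0 \<subseteq> T \<and> independent_on W T} \<noteq> {}"
    using T0 by auto
  from finite_has_maximal[OF this] obtain T where T: "T0 \<subseteq> T" "independent_on W T"
    and max: "\<And>T'. T0 \<subseteq> T' \<Longrightarrow> independent_on W T' \<Longrightarrow> T \<subseteq> T' \<Longrightarrow> T = T'"
    by auto
  have dep: "\<not> independent_on W (insert x T)" if "x \<notin> T" for x
    using max[of "insert x T"] T(1) that by blast
  have "T \<union> - T = UNIV" by auto
  have "\<exists>l\<in>polyfun (T \<union> - T). (\<exists>z\<in>W. l z \<noteq> 0) \<and> (\<forall>a\<in>W. l a \<noteq> 0 \<longrightarrow> lifts_near W T (- T) a)"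
    by (rule triangular_lift[OF irreducible_algebraic_set_prime[OF W] ne T(2)]) (use dep in auto)
  then obtain l where l: "l \<in> polyfun UNIV" "\<exists>z\<in>W. l z \<noteq> 0" and
    lift: "\<forall>a\<in>W. l a \<noteq> 0 \<longrightarrow> lifts_near W T (- T) a"
    unfolding \<open>T \<union> - T = UNIV\<close> by blast
  show ?thesis
  proof (rule that[of T "{z\<in>W. l z = 0}"])
    show "algebraic_set {z\<in>W. l z = 0}"
      using algebraic_set_Int_zeros[OF alg, of "{l}"] l(1) by auto
    fix a U assume a: "a \<in> W - {z\<in>W. l z = 0}" "open U" "a \<in> U"
    obtain e where e: "e > 0" "\<And>z. (\<And>i. cmod (z $ i - a $ i) < e) \<Longrightarrow> z \<in> U"
      using open_coordinate_box[OF a(2,3)] by blast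
    obtain d where d: "d > 0" and dz: "\<And>t. (\<forall>i\<in>T. cmod (t $ i - a $ i) < d) \<Longrightarrow>
      (\<exists>z. (\<forall>i\<in>T. z $ i = t $ i) \<and> (\<forall>i\<in>- T. cmod (z $ i - a $ i) < e) \<and>
        (\<forall>f\<in>polyfun UNIV. (\<forall>w\<in>W. f w = 0) \<longrightarrow> f z = 0))"
    proof -
      have "lifts_near W T (- T) a" using lift a by auto
      then have "\<exists>d>0. \<forall>t. (\<forall>i\<in>T. cmod (t $ i - a $ i) < d) \<longrightarrow>
        (\<exists>z. (\<forall>i\<in>T. z $ i = t $ i) \<and> (\<forall>i\<in>- T. cmod (z $ i - a $ i) < e) \<and>
          (\<forall>f\<in>polyfun UNIV. (\<forall>w\<in>W. f w = 0) \<longrightarrow> f z = 0))"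
        unfolding lifts_near_def \<open>T \<union> - T = UNIV\<close> using e(1) by simp
      then show ?thesis by (elim exE conjE) (rule that, assumption, blast)
    qed
    have "\<exists>z\<in>W \<inter> U. \<forall>i\<in>T. z $ i = t $ i" if t: "\<forall>i\<in>T. cmod (t $ i - a $ i) < min d e" for t
    proof -
      obtain z where z: "\<forall>i\<in>T. z $ i = t $ i" "\<forall>i\<in>- T. cmod (z $ i - a $ i) < e"
        "\<forall>f\<in>polyfun UNIV. (\<forall>w\<in>W. f w = 0) \<longrightarrow> f z = 0"
      proof -
        have "\<forall>i\<in>T. cmod (t $ i - a $ i) < d" using t by simp
        from dz[OF this] show ?thesis by (elim exE conjE) (rule that)
      qed
      have "z \<in> W" using z(3) algebraic_set_vanishing[OF alg] by blast
      moreover have "z \<in> U"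
      proof (rule e(2))
        fix i show "cmod (z $ i - a $ i) < e"
          by (cases "i \<in> T") (use z t in auto)
      qed
      ultimately show ?thesis using z(1) by blast
    qed
    then show "\<exists>d>0. \<forall>t. (\<forall>i\<in>T. cmod (t $ i - a $ i) < d) \<longrightarrow> (\<exists>z\<in>W \<inter> U. \<forall>i\<in>T. z $ i = t $ i)"
      using d e(1) by (intro exI[of _ "min d e"]) auto
  qed (use T dep l in auto)
qed

section \<open>Compact fibres of algebraic sets\<close>

text \<open>The plane without a finite set is connected, but it would be split by the open sets
  \<open>interior C\<close> and \<open>- C\<close>. As \<open>- C\<close> is nonempty, the interior
  is empty and \<open>C\<close> is its own frontier.\<close>

lemma finite_compact_finite_frontier:
  fixes C :: "complex set"
  assumes "compact C" "finite (frontier C)"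
  shows "finite C"
proof -
  have "interior C = {}"
  proof (rule ccontr)
    assume ne: "interior C \<noteq> {}"
    have "connected (UNIV - frontier C)"
      by (intro path_connected_imp_connected path_connected_open_diff_countable)
        (use assms in \<open>auto intro: countable_finite\<close>)
    moreover have "UNIV - frontier C = interior C \<union> - C"
      using assms(1) interior_subset[of C] by (auto simp: frontier_def compact_imp_closed)
    moreover have "C \<noteq> UNIV"
      using assms(1) not_bounded_UNIV[where 'a = complex] compact_imp_bounded by auto
    moreover from this have "- C \<noteq> {}" by auto
    moreover have "open (- C)" using assms(1) compact_imp_closed by auto
    ultimately show False
      using connectedD[of "UNIV - frontier C" "interior C" "- C"] ne interior_subset[of C] by auto
  qed
  then have "C = frontier C"
    using assms(1) by (simp add: frontier_def compact_imp_closed)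
  then show ?thesis using assms(2) by simp
qed

lemma finite_vec_components:
  fixes A :: "(complex ^ 'n::finite) set"
  assumes "\<And>i. finite ((\<lambda>z. z $ i) ` A)"
  shows "finite A"
proof (rule finite_subset)
  show "A \<subseteq> vec_lambda ` (\<Pi>\<^sub>E i\<in>UNIV. (\<lambda>z. z $ i) ` A)"
  proof
    fix z assume "z \<in> A"
    then have "vec_nth z \<in> (\<Pi>\<^sub>E i\<in>UNIV. (\<lambda>z. z $ i) ` A)" by auto
    moreover have "z = vec_lambda (vec_nth z)" by simp
    ultimately show "z \<in> vec_lambda ` (\<Pi>\<^sub>E i\<in>UNIV. (\<lambda>z. z $ i) ` A)" by blast
  qed
qed (intro finite_imageI finite_PiE assms, simp)

lemma infinite_complex_ball: "d > 0 \<Longrightarrow> infinite (ball (c :: complex) d)"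
  using uncountable_ball countable_finite by blast

text \<open>A relation in the single coordinate \<open>x\<close> has constant coefficients, so the
  values are roots of one nonzero polynomial.\<close>

lemma dependent_coordinate_finite:
  assumes "\<not> independent_on W {x}"
  shows "finite ((\<lambda>z. z $ x) ` W)"
proof -
  obtain f z0 where f: "f \<in> polyfun {x}" "\<forall>z\<in>W. f z = 0" "f z0 \<noteq> 0"
    using assms unfolding independent_on_def by auto
  obtain p N where p: "poly_over {} N p" "\<And>z. f z = poly (p z) (z $ x)"
    using polyfun_insert_poly_over[OF f(1)] by blast
  have pz: "p z = p z0" for z
    by (rule poly_eqI) (rule polyfun_cong[OF poly_overD(1)[OF p(1)]], simp)
  have "p z0 \<noteq> 0" using f(3) p(2) by auto
  then have "finite {s. poly (p z0) s = 0}" by (rule poly_roots_finite)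
  moreover have "(\<lambda>z. z $ x) ` W \<subseteq> {s. poly (p z0) s = 0}"
    using f(2) p(2) pz by (metis (mono_tags, lifting) image_subsetI mem_Collect_eq)
  ultimately show ?thesis by (rule rev_finite_subset)
qed

lemma not_irreducibleE:
  assumes "algebraic_set W" "W \<noteq> {}" "\<not> irreducible_algebraic_set W"
  obtains W1 W2 where "algebraic_set W1" "algebraic_set W2" "W = W1 \<union> W2" "W1 \<subset> W" "W2 \<subset> W"
  using assms unfolding irreducible_algebraic_set_def by blast

text \<open>Noetherian induction reduces to irreducible \<open>W\<close>. If \<open>T\<close> is
  empty, each coordinate takes finitely many values. Otherwise the image under a coordinate in
  \<open>T\<close> is compact with frontier in the finite image of \<open>Z \<inter> U\<close>,
  hence finite; a point outside \<open>Z\<close> would put a whole disc into it.\<close>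

lemma finite_compact_open_subset_algebraic:
  fixes W :: "(complex ^ 'n::{finite,linorder}) set"
  assumes "algebraic_set W" "open U" "compact (W \<inter> U)"
  shows "finite (W \<inter> U)"
  using assms(1,3)
proof (induction W rule: algebraic_set_induct)
  case (less W)
  have sub: "compact (W' \<inter> U)" if "algebraic_set W'" "W' \<subseteq> W" for W'
  proof -
    have "W' \<inter> U = W' \<inter> (W \<inter> U)" using that(2) by auto
    then show ?thesis
      using closed_Int_compact[OF closed_algebraic_set[OF that(1)] less.prems] by simp
  qed
  consider "W = {}" | "W \<noteq> {}" "\<not> irreducible_algebraic_set W" | "irreducible_algebraic_set W"
    by blast
  then show ?case
  proof cases
    case 2
    then obtain W1 W2 where W12: "algebraic_set W1" "algebraic_set W2" "W = W1 \<union> W2"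
      "W1 \<subset> W" "W2 \<subset> W"
      using not_irreducibleE[OF less.hyps] by blast
    have "finite (W1 \<inter> U)" "finite (W2 \<inter> U)"
      using less.IH[of W1] less.IH[of W2] sub[of W1] sub[of W2] W12 by auto
    then show ?thesis unfolding W12(3) by (simp add: Int_Un_distrib2)
  next
    case 3
    then have "W \<noteq> {}" unfolding irreducible_algebraic_set_def by blast
    then have "independent_on W {}"
      unfolding independent_on_def by (metis empty_iff ex_in_conv polyfun_cong)
    then obtain T Z where dep: "\<And>x. x \<notin> T \<Longrightarrow> \<not> independent_on W (insert x T)"
      and Z: "algebraic_set Z" "Z \<subset> W"
      and op: "\<And>a U. a \<in> W - Z \<Longrightarrow> open U \<Longrightarrow> a \<in> U \<Longrightarrow>
        \<exists>d>0. \<forall>t. (\<forall>i\<in>T. cmod (t $ i - a $ i) < d) \<longrightarrow> (\<exists>z\<in>W \<inter> U. \<forall>i\<in>T. z $ i = t $ i)"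
      using generic_projection_open[OF 3, of "{}"] by metis
    show ?thesis
    proof (cases "T = {}")
      case True
      have "finite W"
        by (rule finite_vec_components dependent_coordinate_finite)+ (use dep True in auto)
      then show ?thesis by simp
    next
      case False
      then obtain k where "k \<in> T" by blast
      have ball: "\<exists>d>0. ball (a $ k) d \<subseteq> (\<lambda>z. z $ k) ` (W \<inter> U)" if a: "a \<in> W \<inter> U" "a \<notin> Z" for a
      proof -
        obtain d where d: "d > 0" "\<forall>t. (\<forall>i\<in>T. cmod (t $ i - a $ i) < d) \<longrightarrow>
            (\<exists>z\<in>W \<inter> U. \<forall>i\<in>T. z $ i = t $ i)"
          using op[of a U] a assms(2) by auto
        have "s \<in> (\<lambda>z. z $ k) ` (W \<inter> U)" if "s \<in> ball (a $ k) d" for s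
        proof -
          define t :: "(complex, 'n) vec" where "t = (\<chi> i. if i = k then s else a $ i)"
          have "\<forall>i\<in>T. cmod (t $ i - a $ i) < d"
            using that d(1) by (auto simp: t_def dist_norm norm_minus_commute)
          then obtain z where "z \<in> W \<inter> U" "\<forall>i\<in>T. z $ i = t $ i" using d(2) by blast
          then show ?thesis using \<open>k \<in> T\<close> by (auto simp: t_def intro!: image_eqI[of _ _ z])
        qed
        then show ?thesis using d(1) by blast
      qed
      have cpt: "compact ((\<lambda>z. z $ k) ` (W \<inter> U))"
        by (intro compact_continuous_image less.prems continuous_intros)
      have finZ: "finite (Z \<inter> U)" using less.IH[OF Z] sub[OF Z(1)] Z(2) by auto
      \<comment> \<open>A value taken at a point outside \<open>Z\<close> is interior to the image,
        because the projection is open there.\<close>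
      have "frontier ((\<lambda>z. z $ k) ` (W \<inter> U)) \<subseteq> (\<lambda>z. z $ k) ` (Z \<inter> U)"
      proof
        fix s assume s: "s \<in> frontier ((\<lambda>z. z $ k) ` (W \<inter> U))"
        then have "s \<in> (\<lambda>z. z $ k) ` (W \<inter> U)"
          using cpt by (simp add: frontier_def compact_imp_closed)
        then obtain a where a: "a \<in> W \<inter> U" "s = a $ k" by blast
        have "a \<in> Z"
        proof (rule ccontr)
          assume "a \<notin> Z"
          then have "s \<in> interior ((\<lambda>z. z $ k) ` (W \<inter> U))"
            using ball[OF a(1)] a(2) mem_interior by blast
          then show False using s by (simp add: frontier_def)
        qed
        then show "s \<in> (\<lambda>z. z $ k) ` (Z \<inter> U)" using a by blast
      qed
      then have fin: "finite ((\<lambda>z. z $ k) ` (W \<inter> U))"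
        using finite_compact_finite_frontier[OF cpt] finZ finite_subset by blast
      have "W \<inter> U \<subseteq> Z"
      proof
        fix a assume a: "a \<in> W \<inter> U"
        show "a \<in> Z"
        proof (rule ccontr)
          assume "a \<notin> Z"
          then obtain d where "d > 0" "ball (a $ k) d \<subseteq> (\<lambda>z. z $ k) ` (W \<inter> U)"
            using ball[OF a] by blast
          then show False using fin infinite_complex_ball finite_subset by blast
        qed
      qed
      then show ?thesis using finZ by (metis Int_lower2 finite_subset le_inf_iff)
    qed
  qed simp
qed

text \<open>Bivariate polynomials are polynomials with polynomial coefficients: the outer variable
  stands for \<open>z $ i\<close> and is replaced by a constant polynomial, the inner one stands for
  \<open>z $ k\<close>.\<close>

lemma polyfun_pair:
  assumes "f \<in> polyfun {k, i}"
  obtains P where "\<And>z. f z = poly (poly P [:z $ i:]) (z $ k)"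
proof -
  have "\<exists>P. \<forall>z. f z = poly (poly P [:z $ i:]) (z $ k)"
    using assms
  proof (induction rule: polyfun.induct)
    case (const c)
    show ?case by (rule exI[of _ "[:[:c:]:]"]) simp
  next
    case (coord j)
    then show ?case
      by (cases "j = k") (auto intro: exI[of _ "[:[:0, 1:]:]"] exI[of _ "[:0, 1:]"])
  next
    case (add f g)
    then show ?case by (metis poly_add)
  next
    case (mult f g)
    then show ?case by (metis poly_mult)
  qed
  then show ?thesis using that by blast
qed

text \<open>Noetherian induction, multiplying the relations of two pieces. If \<open>W\<close> is
  irreducible with coordinates \<open>k\<close> and \<open>i\<close> independent, then near a point
  outside \<open>Z\<close> coordinate \<open>i\<close> fills a disc while coordinate
  \<open>k\<close> stays fixed, although that fibre is finite. So \<open>W \<inter> U\<close> lies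
  in the smaller set \<open>Z\<close>.\<close>

lemma algebraic_relation_of_compact_fibres:
  fixes W :: "(complex ^ 'n::{finite,linorder}) set"
  assumes "algebraic_set W" "open U" "i \<noteq> k" and "\<And>c. compact (W \<inter> U \<inter> {z. z $ k = c})"
  obtains P where "P \<noteq> 0" "\<And>z. z \<in> W \<inter> U \<Longrightarrow> poly (poly P [:z $ i:]) (z $ k) = 0"
proof -
  have "\<exists>P. P \<noteq> 0 \<and> (\<forall>z\<in>W \<inter> U. poly (poly P [:z $ i:]) (z $ k) = 0)"
    using assms(1,4)
  proof (induction W rule: algebraic_set_induct)
    case (less W)
    have sub: "compact (W' \<inter> U \<inter> {z. z $ k = c})" if "algebraic_set W'" "W' \<subseteq> W" for W' c
    proof -
      have "W' \<inter> U \<inter> {z. z $ k = c} = W' \<inter> (W \<inter> U \<inter> {z. z $ k = c})" using that(2) by auto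
      then show ?thesis
        using closed_Int_compact[OF closed_algebraic_set[OF that(1)] less.prems] by metis
    qed
    consider "W = {}" | "W \<noteq> {}" "\<not> irreducible_algebraic_set W" | "irreducible_algebraic_set W"
      by blast
    then show ?case
    proof cases
      case 1
      then show ?thesis by (intro exI[of _ 1]) auto
    next
      case 2
      then obtain W1 W2 where W12: "algebraic_set W1" "algebraic_set W2" "W = W1 \<union> W2"
        "W1 \<subset> W" "W2 \<subset> W"
        using not_irreducibleE[OF less.hyps] by blast
      obtain P1 where P1: "P1 \<noteq> 0" "\<forall>z\<in>W1 \<inter> U. poly (poly P1 [:z $ i:]) (z $ k) = 0"
        using less.IH[OF W12(1,4) sub[OF W12(1)]] W12(4) by blast
      obtain P2 where P2: "P2 \<noteq> 0" "\<forall>z\<in>W2 \<inter> U. poly (poly P2 [:z $ i:]) (z $ k) = 0"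
        using less.IH[OF W12(2,5) sub[OF W12(2)]] W12(5) by blast
      show ?thesis
        by (rule exI[of _ "P1 * P2"]) (use P1 P2 W12(3) in auto)
    next
      case 3
      show ?thesis
      proof (cases "independent_on W {k, i}")
        case False
        then obtain f z0 where f: "f \<in> polyfun {k, i}" "\<forall>z\<in>W. f z = 0" "f z0 \<noteq> 0"
          unfolding independent_on_def by auto
        obtain P where P: "\<And>z. f z = poly (poly P [:z $ i:]) (z $ k)"
          using polyfun_pair[OF f(1)] by blast
        have "P \<noteq> 0" using f(3) P[of z0] by auto
        then show ?thesis using f(2) P by auto
      next
        case True
        obtain T Z where T: "{k, i} \<subseteq> T" and Z: "algebraic_set Z" "Z \<subset> W"
          and op: "\<And>a U. a \<in> W - Z \<Longrightarrow> open U \<Longrightarrow> a \<in> U \<Longrightarrow>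
            \<exists>d>0. \<forall>t. (\<forall>i\<in>T. cmod (t $ i - a $ i) < d) \<longrightarrow> (\<exists>z\<in>W \<inter> U. \<forall>i\<in>T. z $ i = t $ i)"
          using generic_projection_open[OF 3 True] by metis
        have "W \<inter> U \<subseteq> Z"
        proof
          fix a assume a: "a \<in> W \<inter> U"
          show "a \<in> Z"
          proof (rule ccontr)
            assume "a \<notin> Z"
            then obtain d where d: "d > 0" "\<forall>t. (\<forall>i\<in>T. cmod (t $ i - a $ i) < d) \<longrightarrow>
                (\<exists>z\<in>W \<inter> U. \<forall>i\<in>T. z $ i = t $ i)"
              using op[of a U] a assms(2) by auto
            define F where "F = {z\<in>W. z $ k = a $ k}"
            have "algebraic_set F"
              using algebraic_set_Int_zeros[OF less.hyps, of "{\<lambda>z. z $ k - a $ k}"]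
              unfolding F_def by (simp add: polyfun_intros)
            moreover have "F \<inter> U = W \<inter> U \<inter> {z. z $ k = a $ k}" by (auto simp: F_def)
            ultimately have fin: "finite (F \<inter> U)"
              using finite_compact_open_subset_algebraic assms(2) less.prems by metis
            have "ball (a $ i) d \<subseteq> (\<lambda>z. z $ i) ` (F \<inter> U)"
            proof
              fix s assume s: "s \<in> ball (a $ i) d"
              \<comment> \<open>Only coordinate \<open>i\<close> moves. As \<open>k\<close> is also
                in \<open>T\<close>, the lift keeps the value \<open>a $ k\<close> and stays in the
                fibre \<open>F\<close>.\<close>
              define t :: "(complex, 'n) vec" where "t = (\<chi> j. if j = i then s else a $ j)"
              have "\<forall>j\<in>T. cmod (t $ j - a $ j) < d"
                using s d(1) by (auto simp: t_def dist_norm norm_minus_commute)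
              then obtain z where z: "z \<in> W \<inter> U" "\<forall>j\<in>T. z $ j = t $ j" using d(2) by blast
              then have "z $ k = a $ k" "z $ i = s" using T assms(3) by (auto simp: t_def)
              then show "s \<in> (\<lambda>z. z $ i) ` (F \<inter> U)"
                using z(1) by (auto simp: F_def)
            qed
            then show False using fin infinite_complex_ball[OF d(1)] finite_subset by blast
          qed
        qed
        then have eq: "W \<inter> U = Z \<inter> U" using Z(2) by auto
        show ?thesis unfolding eq
          using less.IH[OF Z sub[OF Z(1)]] Z(2) by auto
      qed
    qed
  qed
  then show ?thesis using that by blast
qed

section \<open>The map theta and symmetric functions\<close>

definition pow_vec :: "nat \<Rightarrow> complex ^ 'n \<Rightarrow> complex ^ 'n" where
  "pow_vec m z = (\<chi> j. (z $ j) ^ m)"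

lemma pow_vec_nth [simp]: "pow_vec m z $ j = (z $ j) ^ m"
  by (simp add: pow_vec_def)

lemma bij_coord_number: "bij_betw coord_number (UNIV :: 'n::{finite,linorder} set) {1..CARD('n)}"
proof -
  have "coord_number i < coord_number j" if "i < j" for i j :: 'n
    unfolding coord_number_def by (rule psubset_card_mono) (use that in auto)
  then have inj: "inj (coord_number :: 'n \<Rightarrow> nat)"
    by (metis injI less_irrefl linorder_less_linear)
  have "coord_number i \<in> {1..CARD('n)}" for i :: 'n
    unfolding coord_number_def by (auto simp: Suc_le_eq card_gt_0_iff intro: card_mono)
  then have "range (coord_number :: 'n \<Rightarrow> nat) = {1..CARD('n)}"
    by (intro card_subset_eq) (auto simp: card_image[OF inj])
  then show ?thesis using inj by (simp add: bij_betw_def)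
qed

definition coord_of :: "nat \<Rightarrow> 'n::{finite,linorder}" where
  "coord_of k = inv_into UNIV coord_number k"

lemma coord_number_of:
  "1 \<le> k \<Longrightarrow> k \<le> CARD('n) \<Longrightarrow> coord_number (coord_of k :: 'n::{finite,linorder}) = k"
  unfolding coord_of_def
  by (rule f_inv_into_f) (use bij_coord_number[where 'n = 'n] in \<open>auto simp: bij_betw_def\<close>)

lemma coord_of_number: "coord_of (coord_number i) = (i :: 'n::{finite,linorder})"
  unfolding coord_of_def
  by (rule inv_into_f_f) (use bij_coord_number[where 'n = 'n] in \<open>auto simp: bij_betw_def\<close>)

lemma coord_number_range:
  "1 \<le> coord_number i" "coord_number i \<le> CARD('n)" for i :: "'n::{finite,linorder}"
  using bij_coord_number[where 'n = 'n] unfolding bij_betw_def by force+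

lemma elem_sym_0 [simp]: "elem_sym 0 (u :: complex ^ 'n::finite) = 1"
proof -
  have "{A :: 'n set. card A = 0} = {{}}" by auto
  then show ?thesis by (simp add: elem_sym_def)
qed

lemma elem_sym_CARD: "elem_sym CARD('n) (u :: complex ^ 'n::finite) = (\<Prod>j\<in>UNIV. u $ j)"
proof -
  have "{A :: 'n set. card A = CARD('n)} = {UNIV}"
    by (auto dest: card_subset_eq[OF finite subset_UNIV])
  then show ?thesis by (simp add: elem_sym_def)
qed

lemma elem_sym_large:
  assumes "CARD('n) < k"
  shows "elem_sym k (u :: complex ^ 'n::finite) = 0"
proof -
  have "card (A :: 'n set) \<le> CARD('n)" for A by (rule card_mono) auto
  then have "{A :: 'n set. card A = k} = {}" using assms by (metis (mono_tags, lifting)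
      empty_Collect_eq not_less)
  then show ?thesis by (simp add: elem_sym_def)
qed

text \<open>Recovers the \<open>k\<close>-th elementary symmetric function of the
  \<open>m\<close>-th powers from \<open>theta m p z\<close>. The last coordinate is the
  \<open>q\<close>-th power of the product with \<open>q = m div p\<close>, hence the exponent
  \<open>p\<close> at \<open>k = CARD('n)\<close>.\<close>

definition theta_coeff :: "nat \<Rightarrow> nat \<Rightarrow> complex ^ 'n::{finite,linorder} \<Rightarrow> complex" where
  "theta_coeff p k y = (if k = 0 then 1 else if k < CARD('n) then y $ coord_of k
    else if k = CARD('n) then (y $ coord_of k) ^ p else 0)"

lemma theta_coeff_polyfun: "theta_coeff p k \<in> polyfun UNIV"
  unfolding theta_coeff_def[abs_def]
  by (cases "k = 0"; cases "k < CARD('a)"; cases "k = CARD('a)") (auto intro!: polyfun_intros)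

lemma theta_coeff_theta:
  fixes z :: "complex ^ 'n::{finite,linorder}"
  assumes "p dvd m"
  shows "theta_coeff p k (theta m p z) = elem_sym k (pow_vec m z)"
proof -
  consider "k = 0" | "1 \<le> k" "k < CARD('n)" | "k = CARD('n)" | "CARD('n) < k" by linarith
  then show ?thesis
  proof cases
    case 2
    then show ?thesis
      by (simp add: theta_coeff_def theta_def coord_number_of pow_vec_def)
  next
    case 3
    have "((\<Prod>j\<in>UNIV. z $ j) ^ (m div p)) ^ p = elem_sym CARD('n) (pow_vec m z)"
      using assms by (simp add: elem_sym_CARD prod_power_distrib flip: power_mult)
    then show ?thesis
      using 3 by (simp add: theta_coeff_def theta_def coord_number_of)
  qed (auto simp: theta_coeff_def elem_sym_large)
qed

lemma theta_component_polyfun: "(\<lambda>z. theta m p z $ i) \<in> polyfun UNIV"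
  by (cases "coord_number i < CARD('a)")
    (auto simp: theta_def elem_sym_def intro!: polyfun_intros)

section \<open>Vieta's formula and the fibres of \<open>theta\<close>\<close>

lemma prod_const_poly: "(\<Prod>x\<in>A. [:f x:]) = [:\<Prod>x\<in>A. f x :: complex:]"
  by (induction A rule: infinite_finite_induct) (auto simp: one_pCons)

text \<open>Vieta's formula: the product of differences is expanded over the subsets
  \<open>X\<close> of factors that contribute their root.\<close>

lemma coeff_prod_linear:
  fixes u :: "complex ^ 'n::finite"
  assumes "k \<le> CARD('n)"
  shows "coeff (\<Prod>j\<in>UNIV. [:- u $ j, 1:]) (CARD('n) - k) = (-1) ^ k * elem_sym k u"
proof -
  have "(\<Prod>j\<in>UNIV. [:- u $ j, 1:]) = (\<Prod>j\<in>UNIV. monom 1 1 - [:u $ j:])"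
    by (intro prod.cong) (auto simp: monom_altdef)
  also have "\<dots> = (\<Sum>X\<in>UNIV. (-1) ^ card X * (\<Prod>x\<in>X. [:u $ x:]) * (\<Prod>x\<in>UNIV - X. monom 1 1))"
    by (subst prod_diff_conv_sum) auto
  also have "\<dots> = (\<Sum>X\<in>UNIV. monom ((-1) ^ card X * (\<Prod>x\<in>X. u $ x)) (CARD('n) - card X))"
  proof (rule sum.cong)
    fix X :: "'n set"
    have "(-1 :: complex poly) ^ card X = [:(-1) ^ card X:]"
      by (metis one_pCons minus_pCons minus_zero poly_const_pow)
    moreover have "(\<Prod>x\<in>UNIV - X. monom 1 1 :: complex poly) = monom 1 (CARD('n) - card X)"
      by (simp add: monom_power card_Diff_subset)
    ultimately show "(-1) ^ card X * (\<Prod>x\<in>X. [:u $ x:]) * (\<Prod>x\<in>UNIV - X. monom 1 1)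
        = monom ((-1) ^ card X * (\<Prod>x\<in>X. u $ x)) (CARD('n) - card X)"
      by (simp add: prod_const_poly smult_monom)
  qed simp
  finally have "coeff (\<Prod>j\<in>UNIV. [:- u $ j, 1:]) (CARD('n) - k)
      = (\<Sum>X\<in>UNIV. if CARD('n) - card X = CARD('n) - k then (-1) ^ card X * (\<Prod>x\<in>X. u $ x) else 0)"
    by (simp add: coeff_sum)
  also have "\<dots> = (\<Sum>X\<in>UNIV. if card X = k then (-1) ^ k * (\<Prod>x\<in>X. u $ x) else 0)"
  proof (rule sum.cong)
    fix X :: "'n set"
    \<comment> \<open>Truncated subtraction can be cancelled because both \<open>card X\<close> and
      \<open>k\<close> are at most \<open>CARD('n)\<close>.\<close>
    have "card X \<le> CARD('n)" by (rule card_mono) auto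
    then have "CARD('n) - card X = CARD('n) - k \<longleftrightarrow> card X = k" using assms by linarith
    then show "(if CARD('n) - card X = CARD('n) - k then (-1) ^ card X * (\<Prod>x\<in>X. u $ x) else 0)
        = (if card X = k then (-1) ^ k * (\<Prod>x\<in>X. u $ x) else 0)" by simp
  qed simp
  also have "\<dots> = (\<Sum>X | card X = k. (-1) ^ k * (\<Prod>x\<in>X. u $ x))"
    by (subst sum.inter_filter[symmetric]) auto
  finally show ?thesis by (simp add: elem_sym_def sum_distrib_left)
qed

lemma degree_prod_linear: "degree (\<Prod>j\<in>(UNIV :: 'n::finite set). [:- u j, 1 :: complex:]) = CARD('n)"
  by (subst degree_prod_eq_sum_degree) auto

lemma elem_sym_eq_imp_prod_linear_eq:
  fixes u v :: "complex ^ 'n::finite"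
  assumes "\<And>k. k \<le> CARD('n) \<Longrightarrow> elem_sym k u = elem_sym k v"
  shows "(\<Prod>j\<in>UNIV. [:- u $ j, 1:]) = (\<Prod>j\<in>UNIV. [:- v $ j, 1:])"
proof (rule poly_eqI)
  fix i
  show "coeff (\<Prod>j\<in>UNIV. [:- u $ j, 1:]) i = coeff (\<Prod>j\<in>UNIV. [:- v $ j, 1:]) i"
  proof (cases "i \<le> CARD('n)")
    case True
    then show ?thesis
      using coeff_prod_linear[of "CARD('n) - i" u] coeff_prod_linear[of "CARD('n) - i" v]
        assms[of "CARD('n) - i"] by simp
  next
    case False
    then show ?thesis by (simp add: coeff_eq_0 degree_prod_linear)
  qed
qed

text \<open>Both points give the same monic polynomial with the \<open>m\<close>-th powers of the
  coordinates as roots, so \<open>(z $ j) ^ m\<close> is also one of the roots coming from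
  \<open>w\<close>.\<close>

lemma theta_eq_imp_components:
  fixes z w :: "complex ^ 'n::{finite,linorder}"
  assumes "p dvd m" "theta m p z = theta m p w"
  obtains k where "(z $ j) ^ m = (w $ k) ^ m"
proof -
  have "elem_sym k (pow_vec m z) = elem_sym k (pow_vec m w)" for k
    using assms theta_coeff_theta by metis
  then have "(\<Prod>j\<in>UNIV. [:- pow_vec m z $ j, 1:]) = (\<Prod>j\<in>UNIV. [:- pow_vec m w $ j, 1:])"
    by (rule elem_sym_eq_imp_prod_linear_eq)
  then have "(\<Prod>k\<in>UNIV. (z $ j) ^ m - (z $ k) ^ m) = (\<Prod>k\<in>UNIV. (z $ j) ^ m - (w $ k) ^ m)"
    using poly_prod[of "\<lambda>k. [:- pow_vec m z $ k, 1:]" UNIV "(z $ j) ^ m"]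
      poly_prod[of "\<lambda>k. [:- pow_vec m w $ k, 1:]" UNIV "(z $ j) ^ m"] by simp
  moreover have "(\<Prod>k\<in>UNIV. (z $ j) ^ m - (z $ k) ^ m) = 0"
    by (subst prod_zero_iff) auto
  ultimately have "\<exists>k. (z $ j) ^ m - (w $ k) ^ m = 0"
    by (metis (mono_tags, lifting) finite prod_zero_iff)
  then show ?thesis using that by auto
qed

lemma monic_poly_roots_vec:
  fixes Q :: "complex poly"
  assumes "degree Q = CARD('n)" "lead_coeff Q = 1"
  obtains u :: "complex ^ 'n::finite" where "Q = (\<Prod>j\<in>UNIV. [:- u $ j, 1:])"
proof -
  obtain xs where xs: "mset xs = proots Q" by (metis ex_mset)
  then have len: "length xs = CARD('n)"
    using size_proots_complex[of Q] assms(1) by (metis size_mset)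
  obtain h where h: "bij_betw h (UNIV :: 'n set) {0..<CARD('n)}"
    using ex_bij_betw_finite_nat[of "UNIV :: 'n set"] by auto
  have "Q = (\<Prod>x\<in>#proots Q. [:- x, 1:])"
    using complex_poly_decompose_multiset[of Q] assms(2) by simp
  also have "\<dots> = (\<Prod>x\<leftarrow>xs. [:- x, 1:])"
    by (simp add: xs[symmetric] flip: prod_mset_prod_list)
  also have "\<dots> = (\<Prod>i=0..<CARD('n). [:- (xs ! i), 1:])"
    by (simp add: prod.list_conv_set_nth len)
  also have "\<dots> = (\<Prod>j\<in>(UNIV :: 'n set). [:- (xs ! h j), 1:])"
    by (rule prod.reindex_bij_betw[OF h, symmetric])
  finally have "Q = (\<Prod>j\<in>UNIV. [:- (\<chi> j. xs ! h j) $ j, 1:])" by simp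
  then show ?thesis by (rule that)
qed

text \<open>The coordinates of \<open>y\<close> prescribe a monic polynomial \<open>Q\<close>;
  \<open>m\<close>-th roots of its roots give a preimage up to the last coordinate, which is then
  corrected by a root of unity.\<close>

lemma theta_surj:
  fixes y :: "complex ^ 'n::{finite,linorder}"
  assumes "m > 0" "p > 0" "p dvd m"
  obtains z where "theta m p z = y"
proof -
  define n where "n = CARD('n)"
  have n: "n \<ge> 1" by (simp add: n_def Suc_le_eq)
  define q where "q = m div p"
  have q: "q * p = m" "q > 0" using assms by (auto simp: q_def)
  define Q where "Q = (\<Sum>k\<le>n. monom ((-1) ^ k * theta_coeff p k y) (n - k))"
  have cQ: "coeff Q (n - k) = (-1) ^ k * theta_coeff p k y" if "k \<le> n" for k
  proof -
    have "coeff Q (n - k) = (\<Sum>l\<le>n. if l = k then (-1) ^ l * theta_coeff p l y else 0)"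
      unfolding Q_def coeff_sum coeff_monom by (rule sum.cong) (use that in auto)
    then show ?thesis using that by simp
  qed
  have "coeff Q n = 1" using cQ[of 0] by (simp add: theta_coeff_def)
  moreover have "degree Q \<le> n"
    unfolding Q_def by (rule degree_sum_le) (auto intro: order_trans[OF degree_monom_le])
  ultimately have "degree Q = n" "lead_coeff Q = 1"
    using le_degree[of Q n] by auto
  then obtain u :: "(complex, 'n) vec" where u: "Q = (\<Prod>j\<in>UNIV. [:- u $ j, 1:])"
    using monic_poly_roots_vec[of Q] unfolding n_def by blast
  have eu: "elem_sym k u = theta_coeff p k y" if "k \<le> n" for k
    using cQ[OF that] coeff_prod_linear[of k u] that unfolding u n_def by simp
  have "\<exists>s. s ^ m = u $ j" for j
  proof -
    obtain w where "u $ j = w ^ m"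
      by (rule exists_complex_root[of m "u $ j"]) (use assms(1) in simp, rule that)
    then show ?thesis by metis
  qed
  then obtain r where r: "\<And>j. r j ^ m = u $ j" by metis
  define y' where "y' = y $ coord_of n"
  have "((\<Prod>j\<in>UNIV. r j) ^ q) ^ p = (\<Prod>j\<in>UNIV. u $ j)"
    by (simp add: r prod_power_distrib q flip: power_mult)
  also have "\<dots> = y' ^ p"
    using eu[of n] n by (simp add: elem_sym_CARD n_def theta_coeff_def y'_def)
  finally have P: "((\<Prod>j\<in>UNIV. r j) ^ q) ^ p = y' ^ p" .
  \<comment> \<open>\<open>y'\<close> and the \<open>q\<close>-th power of the product have the same
    \<open>p\<close>-th power. If nonzero, they differ by a \<open>p\<close>-th root of unity, and a
    \<open>q\<close>-th root \<open>c\<close> of it satisfies \<open>c ^ m = 1\<close>; if zero,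
    \<open>c = 1\<close> works.\<close>
  obtain c where c: "c ^ m = 1" "c ^ q * (\<Prod>j\<in>UNIV. r j) ^ q = y'"
  proof (cases "y' = 0")
    case True
    then show ?thesis using that[of 1] P assms(2) by (simp add: power_0_left)
  next
    case False
    then have nz: "(\<Prod>j\<in>UNIV. r j) ^ q \<noteq> 0" using P assms(2) by (metis power_eq_0_iff)
    obtain c where c: "y' / (\<Prod>j\<in>UNIV. r j) ^ q = c ^ q"
      by (rule exists_complex_root[of q "y' / (\<Prod>j\<in>UNIV. r j) ^ q"]) (use q(2) in simp, rule that)
    have "c ^ m = (y' / (\<Prod>j\<in>UNIV. r j) ^ q) ^ p"
      by (simp add: c flip: q(1) power_mult)
    also have "\<dots> = 1" using P nz False by (simp add: power_divide)
    finally have "c ^ m = 1" .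
    moreover have "c ^ q * (\<Prod>j\<in>UNIV. r j) ^ q = y'"
      using c nz by (metis nonzero_eq_divide_eq)
    ultimately show ?thesis by (rule that)
  qed
  \<comment> \<open>The factor \<open>c\<close> goes into a single coordinate, so the product gains
    exactly one \<open>c\<close> and the \<open>m\<close>-th powers are unchanged.\<close>
  define j0 :: 'n where "j0 = coord_of 1"
  define z :: "(complex, 'n) vec" where "z = (\<chi> j. if j = j0 then c * r j else r j)"
  have "pow_vec m z = u"
    by (auto simp: vec_eq_iff z_def r power_mult_distrib c(1))
  have "(\<Prod>j\<in>UNIV. z $ j) = (\<Prod>j\<in>UNIV. (if j = j0 then c else 1) * r j)"
    by (rule prod.cong) (auto simp: z_def)
  also have "\<dots> = c * (\<Prod>j\<in>UNIV. r j)" by (simp add: prod.distrib)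
  finally have prodz: "(\<Prod>j\<in>UNIV. z $ j) ^ q = y'" using c(2) by (simp add: power_mult_distrib)
  have "theta m p z = y"
  proof (rule vec_eq_iff[THEN iffD2], rule allI)
    fix i :: 'n
    show "theta m p z $ i = y $ i"
    proof (cases "coord_number i < n")
      case True
      then have "theta m p z $ i = elem_sym (coord_number i) (pow_vec m z)"
        by (simp add: theta_def n_def pow_vec_def)
      also have "\<dots> = theta_coeff p (coord_number i) y"
        using eu[of "coord_number i"] True \<open>pow_vec m z = u\<close> by simp
      also have "\<dots> = y $ i"
        using True coord_number_range(1)[of i] by (simp add: theta_coeff_def n_def coord_of_number)
      finally show ?thesis .
    next
      case False
      then have "coord_number i = n" using coord_number_range(2)[of i] by (simp add: n_def)
      then have "y $ i = y'" by (metis y'_def coord_of_number)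
      then show ?thesis using False prodz by (simp add: theta_def n_def q_def)
    qed
  qed
  then show ?thesis by (rule that)
qed

text \<open>The index set \<open>B\<close> is arbitrary because Newton's identities also use the
  product with one factor removed.\<close>

lemma fps_nth_prod_linear:
  fixes u :: "'n::finite \<Rightarrow> complex"
  shows "fps_nth (\<Prod>j\<in>B. 1 - fps_const (u j) * fps_X) N
    = (-1) ^ N * (\<Sum>A | A \<subseteq> B \<and> card A = N. \<Prod>j\<in>A. u j)"
proof -
  have expand: "(-1) ^ card A * (\<Prod>x\<in>A. fps_const (u x) * fps_X) * (\<Prod>x\<in>B - A. 1)
      = fps_const ((-1) ^ card A * (\<Prod>x\<in>A. u x)) * fps_X ^ card A" for A
  proof -
    have "(\<Prod>x\<in>A. fps_const (u x)) = fps_const (\<Prod>x\<in>A. u x)"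
      by (induction A rule: infinite_finite_induct) auto
    moreover have "(-1 :: complex fps) ^ card A = fps_const ((-1) ^ card A)"
      by (metis fps_const_1_eq_1 fps_const_neg fps_const_power)
    ultimately show ?thesis by (simp add: prod.distrib mult.assoc flip: fps_const_mult)
  qed
  have "(\<Prod>j\<in>B. 1 - fps_const (u j) * fps_X)
      = (\<Sum>A\<in>Pow B. fps_const ((-1) ^ card A * (\<Prod>x\<in>A. u x)) * fps_X ^ card A)"
    by (simp only: prod_diff_conv_sum[OF finite] expand)
  then have "fps_nth (\<Prod>j\<in>B. 1 - fps_const (u j) * fps_X) N
      = (\<Sum>A\<in>Pow B. if card A = N then (-1) ^ N * (\<Prod>x\<in>A. u x) else 0)"
    by (simp add: fps_sum_nth fps_X_power_iff if_distrib cong: if_cong sum.cong)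
      (auto intro!: sum.cong)
  also have "\<dots> = (\<Sum>A | A \<in> Pow B \<and> card A = N. (-1) ^ N * (\<Prod>x\<in>A. u x))"
    by (subst sum.inter_filter[symmetric]) auto
  finally show ?thesis by (simp add: sum_distrib_left)
qed

text \<open>Multiplying \<open>E\<close> by the geometric series \<open>S j\<close> removes the
  factor of \<open>j\<close>. Summed over \<open>j\<close>, each set \<open>A\<close> of size
  \<open>N\<close> is counted once for every \<open>j\<close> outside it, that is
  \<open>CARD('n) - N\<close> times. The term \<open>i = N\<close> contains the power sum of
  exponent 0, which is \<open>CARD('n)\<close>.\<close>

lemma Newton_identity:
  fixes u :: "complex ^ 'n::finite"
  shows "(\<Sum>i\<le>N. (-1) ^ i * elem_sym i u * (\<Sum>j\<in>UNIV. (u $ j) ^ (N - i)))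
    = (-1) ^ N * (of_nat CARD('n) - of_nat N) * elem_sym N u"
proof -
  define E where "E = (\<Prod>j\<in>UNIV. 1 - fps_const (u $ j) * fps_X)"
  define S where "S j = Abs_fps (\<lambda>N. (u $ j) ^ N)" for j
  have S: "(1 - fps_const (u $ j) * fps_X) * S j = 1" for j
  proof (rule fps_ext)
    show "fps_nth ((1 - fps_const (u $ j) * fps_X) * S j) k = fps_nth 1 k" for k
      by (cases k) (simp_all add: left_diff_distrib mult.assoc S_def)
  qed
  have ES: "E * S j = (\<Prod>i\<in>UNIV - {j}. 1 - fps_const (u $ i) * fps_X)" for j
  proof -
    have "E * S j = ((1 - fps_const (u $ j) * fps_X) * S j) * (\<Prod>i\<in>UNIV - {j}. 1 - fps_const (u $ i) * fps_X)"
      unfolding E_def by (subst prod.remove[of UNIV j]) (auto simp: mult_ac)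
    then show ?thesis by (simp add: S)
  qed
  have En: "fps_nth E i = (-1) ^ i * elem_sym i u" for i
    unfolding E_def fps_nth_prod_linear elem_sym_def by simp
  have "(\<Sum>i\<le>N. (-1) ^ i * elem_sym i u * (\<Sum>j\<in>UNIV. (u $ j) ^ (N - i)))
      = fps_nth (E * (\<Sum>j\<in>UNIV. S j)) N"
    by (simp add: fps_mult_nth En fps_sum_nth S_def atLeast0AtMost)
  also have "\<dots> = (\<Sum>j\<in>UNIV. fps_nth (E * S j) N)"
    by (simp add: sum_distrib_left fps_sum_nth)
  also have "\<dots> = (-1) ^ N * (\<Sum>j\<in>UNIV. \<Sum>A | A \<subseteq> UNIV - {j} \<and> card A = N. \<Prod>i\<in>A. u $ i)"
    by (simp add: ES fps_nth_prod_linear sum_distrib_left)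
  also have "(\<Sum>j\<in>UNIV. \<Sum>A | A \<subseteq> UNIV - {j} \<and> card A = N. \<Prod>i\<in>A. u $ i)
      = (\<Sum>j\<in>UNIV. \<Sum>A | card A = N. if j \<in> A then 0 else (\<Prod>i\<in>A. u $ i))"
  proof (rule sum.cong)
    fix j :: 'n
    have "{A. A \<subseteq> UNIV - {j} \<and> card A = N} = {A \<in> {A. card A = N}. j \<notin> A}" by auto
    then have "(\<Sum>A | A \<subseteq> UNIV - {j} \<and> card A = N. \<Prod>i\<in>A. u $ i)
        = (\<Sum>A | card A = N. if j \<notin> A then (\<Prod>i\<in>A. u $ i) else 0)"
      by (simp only:) (rule sum.inter_filter, simp)
    then show "(\<Sum>A | A \<subseteq> UNIV - {j} \<and> card A = N. \<Prod>i\<in>A. u $ i)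
        = (\<Sum>A | card A = N. if j \<in> A then 0 else (\<Prod>i\<in>A. u $ i))"
      by (simp only:) (rule sum.cong, auto)
  qed simp
  also have "\<dots> = (\<Sum>A | card A = N. \<Sum>j\<in>UNIV. if j \<in> A then 0 else (\<Prod>i\<in>A. u $ i))"
    by (rule sum.swap)
  also have "\<dots> = (\<Sum>A | card A = N. (of_nat CARD('n) - of_nat N) * (\<Prod>i\<in>A. u $ i))"
  proof (rule sum.cong)
    fix A :: "'n set" assume A: "A \<in> {A. card A = N}"
    have "(\<Sum>j\<in>UNIV. if j \<in> A then 0 else (\<Prod>i\<in>A. u $ i)) = (\<Sum>j\<in>- A. \<Prod>i\<in>A. u $ i)"
      by (rule sum.mono_neutral_cong_right) auto
    also have "\<dots> = of_nat (CARD('n) - N) * (\<Prod>i\<in>A. u $ i)"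
      using A by (simp add: card_Diff_subset Compl_eq_Diff_UNIV)
    also have "of_nat (CARD('n) - N) = (of_nat CARD('n) - of_nat N :: complex)"
      using A by (intro of_nat_diff) (auto intro: card_mono)
    finally show "(\<Sum>j\<in>UNIV. if j \<in> A then 0 else (\<Prod>i\<in>A. u $ i))
        = (of_nat CARD('n) - of_nat N) * (\<Prod>i\<in>A. u $ i)" .
  qed simp
  finally show ?thesis by (simp add: elem_sym_def sum_distrib_left mult.assoc)
qed

text \<open>In Newton's identity the \<open>N\<close>-th power sum has coefficient
  \<open>elem_sym 0 = 1\<close>, so it can be solved for recursively.\<close>

lemma power_sum_polyfun_theta:
  assumes "p dvd m"
  obtains g where "g \<in> polyfun UNIV"
    "\<And>z :: complex ^ 'n::{finite,linorder}. g (theta m p z) = (\<Sum>j\<in>UNIV. ((z $ j) ^ m) ^ N)"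
proof -
  have "\<exists>g\<in>polyfun UNIV. \<forall>z :: (complex, 'n) vec. g (theta m p z) = (\<Sum>j\<in>UNIV. ((z $ j) ^ m) ^ N)"
  proof (induction N rule: less_induct)
    case (less N)
    then have "\<forall>k\<in>{..<N}. \<exists>g. g \<in> polyfun UNIV \<and>
        (\<forall>z :: (complex, 'n) vec. g (theta m p z) = (\<Sum>j\<in>UNIV. ((z $ j) ^ m) ^ k))"
      by blast
    from bchoice[OF this] obtain G where "\<forall>k\<in>{..<N}. G k \<in> polyfun UNIV \<and>
        (\<forall>z :: (complex, 'n) vec. G k (theta m p z) = (\<Sum>j\<in>UNIV. ((z $ j) ^ m) ^ k))"
      by (elim exE) (rule that)
    then have G: "\<And>k. k < N \<Longrightarrow> G k \<in> polyfun UNIV"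
      "\<And>k z. k < N \<Longrightarrow> G k (theta m p z) = (\<Sum>j\<in>UNIV. ((z $ j) ^ m) ^ k)" by blast+
    define g where "g y = (-1) ^ N * (of_nat CARD('n) - of_nat N) * theta_coeff p N y
      - (\<Sum>i\<in>{1..N}. (-1) ^ i * theta_coeff p i y * G (N - i) y)" for y :: "(complex, 'n) vec"
    have "g (theta m p z) = (\<Sum>j\<in>UNIV. ((z $ j) ^ m) ^ N)" for z
    proof -
      let ?t = "\<lambda>i. (-1) ^ i * elem_sym i (pow_vec m z) * (\<Sum>j\<in>UNIV. (pow_vec m z $ j) ^ (N - i))"
      have "(\<Sum>i\<in>{1..N}. (-1) ^ i * theta_coeff p i (theta m p z) * G (N - i) (theta m p z))
          = (\<Sum>i\<in>{1..N}. ?t i)"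
        by (rule sum.cong) (auto simp: G theta_coeff_theta[OF assms])
      moreover have "(\<Sum>i\<le>N. ?t i) = ?t 0 + (\<Sum>i\<in>{1..N}. ?t i)"
      proof -
        have "{..N} = insert 0 {1..N}" by auto
        then show ?thesis by simp
      qed
      ultimately show ?thesis
        using Newton_identity[of "pow_vec m z" N]
        by (simp add: g_def theta_coeff_theta[OF assms] diff_eq_eq)
    qed
    moreover have "g \<in> polyfun UNIV"
      unfolding g_def[abs_def] by (intro polyfun_intros theta_coeff_polyfun G(1)) auto
    ultimately show ?case by blast
  qed
  then show ?thesis using that by blast
qed

section \<open>Distinguished varieties\<close>

lemma open_polydisc: "open (polydisc :: (complex ^ 'n::finite) set)"
proof -
  have "polydisc = (\<Inter>j\<in>UNIV. {z :: complex ^ 'n. cmod (z $ j) < 1})"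
    by (auto simp: polydisc_def)
  moreover have "open (\<Inter>j\<in>UNIV. {z :: complex ^ 'n. cmod (z $ j) < 1})"
    by (intro open_INT ballI open_Collect_less continuous_intros) auto
  ultimately show ?thesis by (rule ssubst)
qed

lemma mem_polydisc: "z \<in> polydisc \<longleftrightarrow> (\<forall>j. cmod (z $ j) < 1)"
  by (simp add: polydisc_def)

lemma closure_polydisc_subset: "closure polydisc \<subseteq> {z :: complex ^ 'n::finite. \<forall>j. cmod (z $ j) \<le> 1}"
proof (rule closure_minimal)
  have "{z :: complex ^ 'n. \<forall>j. cmod (z $ j) \<le> 1} = (\<Inter>j. {z. cmod (z $ j) \<le> 1})" by auto
  moreover have "closed {z :: complex ^ 'n. cmod (z $ j) \<le> 1}" for j
    by (intro closed_Collect_le continuous_intros)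
  ultimately show "closed {z :: complex ^ 'n. \<forall>j. cmod (z $ j) \<le> 1}" by auto
qed (auto simp: mem_polydisc less_imp_le)

lemma bounded_polydisc: "bounded (polydisc :: (complex ^ 'n::finite) set)"
  unfolding bounded_iff
proof (intro exI ballI)
  fix z :: "complex ^ 'n" assume "z \<in> polydisc"
  then have "(\<Sum>j\<in>UNIV. cmod (z $ j)) \<le> (\<Sum>j\<in>(UNIV :: 'n set). 1)"
    by (intro sum_mono) (auto simp: mem_polydisc less_imp_le)
  moreover have "norm z \<le> (\<Sum>j\<in>UNIV. cmod (z $ j))"
    unfolding norm_vec_def by (rule L2_set_le_sum) auto
  ultimately show "norm z \<le> (\<Sum>j\<in>(UNIV :: 'n set). 1)" by linarith
qed

lemma norm_power_eq_1_iff: "m > 0 \<Longrightarrow> cmod (s ^ m) = 1 \<longleftrightarrow> cmod s = 1"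
  using power_eq_iff_eq_base[of m "cmod s" 1] by (simp add: norm_power)

lemma norm_power_less_1_iff: "m > 0 \<Longrightarrow> cmod (s ^ m) < 1 \<longleftrightarrow> cmod s < 1"
  using power_less_one_iff[of "cmod s" m] by (simp add: norm_power)

lemma continuous_on_theta: "continuous_on A (theta m p)"
proof -
  have "continuous_on A (\<lambda>z. \<chi> i. theta m p z $ i)"
    by (intro continuous_on_vec_lambda continuous_on_polyfun[OF theta_component_polyfun])
  then show ?thesis by simp
qed

section \<open>Bivariate relations and their specialisation\<close>

lemma bivariate_polyfun: "(\<lambda>z. poly (poly P [:z $ i:]) (z $ k)) \<in> polyfun UNIV"
proof (induction P)
  case (pCons a P)
  have "(\<lambda>z. poly a (z $ k)) \<in> polyfun UNIV"
    unfolding poly_altdef by (intro polyfun_intros) auto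
  moreover have "(\<lambda>z. z $ i * poly (poly P [:z $ i:]) (z $ k)) \<in> polyfun UNIV"
    using pCons by (intro polyfun_intros) auto
  ultimately show ?case by (simp add: polyfun.add)
qed (simp add: polyfun.const)

lemma bivariate_specialize:
  "poly (map_poly (\<lambda>q. poly q a) P) b = poly (poly P [:b:]) (a :: complex)"
  by (induction P) (simp_all add: map_poly_pCons)

text \<open>If \<open>P\<close> vanishes identically when the inner variable is \<open>a\<close>,
  then \<open>[:- a, 1:]\<close> divides every coefficient and can be cancelled, since
  \<open>h z \<noteq> a\<close> on \<open>S\<close>. Each cancellation lowers the degree of the
  leading coefficient.\<close>

lemma bivariate_relation_nonzero_at:
  fixes P :: "complex poly poly"
  assumes "P \<noteq> 0" "\<And>z. z \<in> S \<Longrightarrow> poly (poly P [:g z:]) (h z) = 0" "\<And>z. z \<in> S \<Longrightarrow> h z \<noteq> a"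
  obtains Q where "map_poly (\<lambda>q. poly q a) Q \<noteq> 0" "\<And>z. z \<in> S \<Longrightarrow> poly (poly Q [:g z:]) (h z) = 0"
proof -
  have "\<exists>Q. map_poly (\<lambda>q. poly q a) Q \<noteq> 0 \<and> (\<forall>z\<in>S. poly (poly Q [:g z:]) (h z) = 0)"
    using assms(1,2)
  proof (induction "degree (lead_coeff P)" arbitrary: P rule: less_induct)
    case less
    show ?case
    proof (cases "map_poly (\<lambda>q. poly q a) P = 0")
      case False
      then show ?thesis using less.prems by blast
    next
      case True
      have "[:- a, 1:] dvd coeff P n" for n
        using arg_cong[OF True, of "\<lambda>q. coeff q n"] by (simp add: coeff_map_poly poly_eq_0_iff_dvd)
      then have "[:[:- a, 1:]:] dvd P" by (simp add: const_poly_dvd_iff)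
      then obtain Q where Q: "P = [:[:- a, 1:]:] * Q" by (elim dvdE)
      then have "Q \<noteq> 0" using less.prems(1) by auto
      have "lead_coeff P = [:- a, 1:] * lead_coeff Q"
        unfolding Q by (simp add: lead_coeff_mult)
      then have "degree (lead_coeff Q) < degree (lead_coeff P)"
        using \<open>Q \<noteq> 0\<close> by (simp add: degree_mult_eq del: mult_pCons_left)
      moreover have "poly (poly Q [:g z:]) (h z) = 0" if "z \<in> S" for z
        using less.prems(2)[OF that] assms(3)[OF that] unfolding Q by simp
      ultimately show ?thesis using less.hyps[of Q] \<open>Q \<noteq> 0\<close> by blast
    qed
  qed
  then show ?thesis using that by blast
qed

section \<open>Tools for separating points by polynomials\<close>

lemma polynomially_convexI:
  fixes K :: "(complex ^ 'n::finite) set"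
  assumes "K \<noteq> {}"
    and "\<And>x. x \<notin> K \<Longrightarrow> \<exists>f\<in>polyfun UNIV. \<exists>B. (\<forall>z\<in>K. cmod (f z) \<le> B) \<and> B < cmod (f x)"
  shows "polynomially_convex K"
  unfolding polynomially_convex_def
proof (intro allI impI)
  fix x assume "x \<notin> K"
  then obtain f B where f: "f \<in> polyfun UNIV" "\<And>z. z \<in> K \<Longrightarrow> cmod (f z) \<le> B" "B < cmod (f x)"
    using assms(2) by blast
  obtain g :: "'n cpoly" where g: "\<And>z. f z = eval_cpoly g z"
    using polyfun_eval_cpoly[OF f(1)] by blast
  have "bdd_above ((\<lambda>z. cmod (eval_cpoly g z)) ` K)"
    using f(2) by (auto simp: g intro!: bdd_aboveI)
  moreover have "(SUP z\<in>K. cmod (eval_cpoly g z)) \<le> B"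
    using assms(1) f(2) by (intro cSUP_least) (auto simp: g)
  ultimately show "\<exists>f :: 'n cpoly. bdd_above ((\<lambda>z. cmod (eval_cpoly f z)) ` K) \<and>
      cmod (eval_cpoly f x) > (SUP z\<in>K. cmod (eval_cpoly f z))"
    using f(3) g by (intro exI[of _ g]) auto
qed

lemma polyfun_separating_finite:
  fixes x :: "complex ^ 'n::finite"
  assumes "finite D" "x \<notin> D"
  obtains f where "f \<in> polyfun UNIV" "f x = 1" "\<And>y. y \<in> D \<Longrightarrow> f y = 0"
proof -
  have "\<forall>b\<in>D. \<exists>k. x $ k \<noteq> b $ k" using assms(2) by (metis vec_eq_iff)
  then obtain k where k: "\<And>b. b \<in> D \<Longrightarrow> x $ k b \<noteq> b $ k b" by metis
  define f where "f y = (\<Prod>b\<in>D. (y $ k b - b $ k b) * inverse (x $ k b - b $ k b))" for y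
  show ?thesis
  proof
    show "f \<in> polyfun UNIV" unfolding f_def[abs_def] by (intro polyfun_intros) auto
    show "f x = 1" unfolding f_def by (rule prod.neutral) (use k in auto)
    show "f y = 0" if "y \<in> D" for y
      unfolding f_def using assms(1) that by (intro prod_zero) auto
  qed
qed

lemma symmetric_sum_polyfun_theta:
  fixes c :: "complex poly"
  assumes "p dvd m"
  obtains g where "g \<in> polyfun UNIV"
    "\<And>z :: complex ^ 'n::{finite,linorder}. g (theta m p z) = (\<Sum>j\<in>UNIV. poly c ((z $ j) ^ m))"
proof -
  have "\<forall>N. \<exists>g. g \<in> polyfun UNIV \<and>
      (\<forall>z :: (complex, 'n) vec. g (theta m p z) = (\<Sum>j\<in>UNIV. ((z $ j) ^ m) ^ N))"
    using power_sum_polyfun_theta[OF assms] by metis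
  from choice[OF this] obtain G where "\<forall>N. G N \<in> polyfun UNIV \<and>
      (\<forall>z :: (complex, 'n) vec. G N (theta m p z) = (\<Sum>j\<in>UNIV. ((z $ j) ^ m) ^ N))"
    by (elim exE) (rule that)
  then have G: "\<And>N. G N \<in> polyfun UNIV"
    "\<And>N z. G N (theta m p z) = (\<Sum>j\<in>UNIV. ((z $ j) ^ m) ^ N)" by blast+
  show ?thesis
  proof
    show "(\<lambda>y. \<Sum>N\<le>degree c. coeff c N * G N y) \<in> polyfun UNIV"
      by (intro polyfun_intros G(1))
    show "(\<Sum>N\<le>degree c. coeff c N * G N (theta m p z)) = (\<Sum>j\<in>UNIV. poly c ((z $ j) ^ m))"
      for z :: "(complex, 'n) vec"
      by (simp add: G(2) poly_altdef sum_distrib_left sum.swap[of _ UNIV])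
  qed
qed

text \<open>If \<open>cmod (1 + w) \<ge> 2\<close>, expanding the square gives
  \<open>Re w \<ge> 1\<close>, and the closed unit disc meets this half plane only in 1.\<close>

lemma norm_one_plus_less:
  assumes "cmod w \<le> 1" "w \<noteq> 1"
  shows "cmod ((1 + w) / 2) < 1"
proof (rule ccontr)
  assume "\<not> ?thesis"
  then have "2 \<le> cmod (1 + w)" by (simp add: norm_divide)
  then have "4 \<le> (cmod (1 + w))\<^sup>2" using power_mono[of 2 "cmod (1 + w)" 2] by simp
  moreover have "(cmod (1 + w))\<^sup>2 = 1 + 2 * Re w + (cmod w)\<^sup>2"
    unfolding cmod_power2 by (simp add: power2_eq_square algebra_simps)
  moreover have "(cmod w)\<^sup>2 \<le> 1" using assms(1) by (simp add: power_le_one)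
  ultimately have "Re w \<ge> 1" by linarith
  moreover have "(Re w)\<^sup>2 + (Im w)\<^sup>2 \<le> 1" using \<open>(cmod w)\<^sup>2 \<le> 1\<close> by (simp add: cmod_power2)
  moreover have "Re w \<le> 1" using assms(1) complex_Re_le_cmod[of w] by linarith
  ultimately have "Re w = 1" "Im w = 0" by auto
  then show False using assms(2) by (simp add: complex_eq_iff)
qed

lemma compact_bound_less_1:
  fixes h :: "'a::topological_space \<Rightarrow> real"
  assumes "compact A" "continuous_on A h" "\<And>w. w \<in> A \<Longrightarrow> h w < 1"
  shows "\<exists>r<1. \<forall>w\<in>A. h w \<le> r"
proof (cases "A = {}")
  case True
  then show ?thesis by (auto intro: exI[of _ 0])
next
  case False
  then obtain w where "w \<in> A" "\<forall>y\<in>A. h y \<le> h w"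
    using continuous_attains_sup[OF assms(1) _ assms(2)] by blast
  then show ?thesis using assms(3) by blast
qed

section \<open>The preimage of a distinguished variety in the polydisc\<close>

locale distinguished =
  fixes m p :: nat and \<Omega> V :: "(complex ^ 'n::{finite,linorder}) set"
  assumes m: "m > 0" and p: "p > 0" and pm: "p dvd m"
    and V: "algebraic_set V" and \<Omega>: "\<Omega> = V \<inter> Theta_domain m p" and ne: "\<Omega> \<noteq> {}"
    and boundary: "closure \<Omega> \<inter> frontier (Theta_domain m p) \<subseteq> distinguished_boundary m p"
begin

definition S where "S = theta m p -` V \<inter> polydisc"

lemma algebraic_lift: "algebraic_set (theta m p -` V)"
  by (rule algebraic_set_vimage[OF V theta_component_polyfun])

lemma theta_S: "theta m p ` S = \<Omega>"
  unfolding S_def \<Omega> Theta_domain_def by auto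

lemma closure_S_polydisc: "z \<in> closure S \<Longrightarrow> cmod (z $ j) \<le> 1"
  using closure_mono[of S polydisc] closure_polydisc_subset unfolding S_def by blast

lemma compact_closure_S: "compact (closure S)"
  using bounded_polydisc bounded_subset[of polydisc S] by (simp add: S_def)

lemma closure_S_lift: "closure S \<subseteq> theta m p -` V"
  by (rule closure_minimal) (auto simp: S_def closed_algebraic_set[OF algebraic_lift])

text \<open>Continuity gives one inclusion; for the other, the image of the compact
  \<open>closure S\<close> is closed and contains \<open>\<Omega>\<close>.\<close>

lemma theta_closure_S: "theta m p ` closure S = closure \<Omega>"
proof
  have "theta m p ` closure S \<subseteq> closure (theta m p ` S)"
    by (rule continuous_image_closure_subset[OF continuous_on_theta[of UNIV]]) auto
  then show "theta m p ` closure S \<subseteq> closure \<Omega>" by (simp add: theta_S)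
  have "closed (theta m p ` closure S)"
    by (intro compact_imp_closed compact_continuous_image continuous_on_theta compact_closure_S)
  moreover have "\<Omega> \<subseteq> theta m p ` closure S" using theta_S closure_subset by blast
  ultimately show "closure \<Omega> \<subseteq> theta m p ` closure S" by (simp add: closure_minimal)
qed

text \<open>Equal values of \<open>theta\<close> match the \<open>m\<close>-th powers of
  coordinates, so a coordinate of modulus 1 keeps \<open>theta m p z\<close> out of the domain. The
  image is then a frontier point of the closure, by \<open>boundary\<close> it comes from the torus,
  and matching again gives modulus 1 everywhere.\<close>

lemma closure_S_torus:
  assumes z: "z \<in> closure S" "cmod (z $ j) = 1"
  shows "cmod (z $ k) = 1"
proof -
  have "theta m p z \<notin> Theta_domain m p"
  proof
    assume "theta m p z \<in> Theta_domain m p"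
    then obtain w where w: "w \<in> polydisc" "theta m p z = theta m p w"
      unfolding Theta_domain_def by auto
    obtain l where "(z $ j) ^ m = (w $ l) ^ m" using theta_eq_imp_components[OF pm w(2)] .
    then show False
      using w(1) z(2) m norm_power_eq_1_iff[OF m, of "z $ j"] norm_power_less_1_iff[OF m, of "w $ l"]
      by (simp add: mem_polydisc)
  qed
  moreover have cl: "theta m p z \<in> closure \<Omega>" using z(1) theta_closure_S by blast
  moreover have "closure \<Omega> \<subseteq> closure (Theta_domain m p)" unfolding \<Omega> by (intro closure_mono) auto
  ultimately have "theta m p z \<in> frontier (Theta_domain m p)"
    unfolding frontier_def using interior_subset by blast
  then obtain t where t: "t \<in> torus" "theta m p z = theta m p t"
    using boundary cl unfolding distinguished_boundary_def by blast
  obtain l where l: "(z $ k) ^ m = (t $ l) ^ m" using theta_eq_imp_components[OF pm t(2)] .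
  have "cmod (t $ l) = 1" using t(1) by (simp add: torus_def)
  then show ?thesis using l norm_power_eq_1_iff[OF m] by metis
qed

text \<open>Fixing a coordinate at a value of modulus below 1 keeps points of
  \<open>closure S\<close> off the torus, hence inside the open polydisc; the fibre is a closed
  slice of a compact set.\<close>

lemma compact_fibre: "compact (theta m p -` V \<inter> polydisc \<inter> {z. z $ k = c})"
proof (cases "cmod c < 1")
  case False
  then have "theta m p -` V \<inter> polydisc \<inter> {z. z $ k = c} = {}" by (auto simp: mem_polydisc)
  then show ?thesis by (metis compact_empty)
next
  case True
  have "theta m p -` V \<inter> polydisc \<inter> {z. z $ k = c} = closure S \<inter> {z. z $ k = c}"
  proof
    show "theta m p -` V \<inter> polydisc \<inter> {z. z $ k = c} \<subseteq> closure S \<inter> {z. z $ k = c}"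
      using closure_subset[of S] by (auto simp: S_def)
    show "closure S \<inter> {z. z $ k = c} \<subseteq> theta m p -` V \<inter> polydisc \<inter> {z. z $ k = c}"
    proof
      fix z assume z: "z \<in> closure S \<inter> {z. z $ k = c}"
      have "cmod (z $ j) < 1" for j
        using closure_S_polydisc[of z j] closure_S_torus[of z j k] z True by fastforce
      then show "z \<in> theta m p -` V \<inter> polydisc \<inter> {z. z $ k = c}"
        using z closure_S_lift by (auto simp: mem_polydisc)
    qed
  qed
  moreover have "closed {z :: (complex, 'n) vec. z $ k = c}"
    by (intro closed_Collect_eq continuous_intros)
  ultimately show ?thesis using compact_closure_S by (simp add: compact_Int_closed)
qed

text \<open>A relation between \<open>z $ i\<close> and \<open>z $ k\<close> on \<open>S\<close>
  extends to the closure by continuity. Coordinate \<open>k\<close> never equals \<open>a\<close> on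
  \<open>S\<close>, so the relation can be chosen nontrivial at \<open>a\<close>, and it leaves
  finitely many values for \<open>z $ i\<close>.\<close>

lemma finite_boundary_fibre:
  assumes "cmod a = 1"
  shows "finite {z \<in> closure S. z $ k = a}"
proof (rule finite_vec_components)
  fix i
  show "finite ((\<lambda>z. z $ i) ` {z \<in> closure S. z $ k = a})"
  proof (cases "i = k")
    case True
    then have "(\<lambda>z. z $ i) ` {z \<in> closure S. z $ k = a} \<subseteq> {a}" by auto
    then show ?thesis by (rule finite_subset) simp
  next
    case False
    obtain P where P: "P \<noteq> 0" "\<And>z. z \<in> S \<Longrightarrow> poly (poly P [:z $ i:]) (z $ k) = 0"
      using algebraic_relation_of_compact_fibres[OF algebraic_lift open_polydisc False compact_fibre]
      unfolding S_def by blast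
    have "z $ k \<noteq> a" if "z \<in> S" for z
      using that assms unfolding S_def by (metis Int_iff less_irrefl mem_polydisc)
    then obtain Q where Q: "map_poly (\<lambda>q. poly q a) Q \<noteq> 0"
      "\<And>z. z \<in> S \<Longrightarrow> poly (poly Q [:z $ i:]) (z $ k) = 0"
      using bivariate_relation_nonzero_at[of P S "\<lambda>z. z $ i" "\<lambda>z. z $ k" a] P by metis
    have "closure S \<subseteq> {z. poly (poly Q [:z $ i:]) (z $ k) = 0}"
      by (intro closure_minimal closed_Collect_eq continuous_on_polyfun[OF bivariate_polyfun]
          continuous_on_const) (use Q(2) in auto)
    then have "(\<lambda>z. z $ i) ` {z \<in> closure S. z $ k = a} \<subseteq> {b. poly (map_poly (\<lambda>q. poly q a) Q) b = 0}"
      by (auto simp: bivariate_specialize)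
    then show ?thesis using poly_roots_finite[OF Q(1)] by (rule finite_subset)
  qed
qed

text \<open>Coordinates on \<open>closure S\<close> have modulus at most 1, so
  \<open>(w $ k) ^ m = a\<close> forces modulus exactly 1; there are finitely many
  \<open>m\<close>-th roots of \<open>a\<close>, each with a finite fibre.\<close>

lemma finite_peak_points:
  assumes "cmod a \<ge> 1"
  shows "finite {w \<in> closure S. \<exists>k. (w $ k) ^ m = a}"
proof (rule finite_subset)
  show "{w \<in> closure S. \<exists>k. (w $ k) ^ m = a}
      \<subseteq> (\<Union>k. \<Union>b\<in>{b. b ^ m = a \<and> cmod b = 1}. {w \<in> closure S. w $ k = b})"
  proof safe
    fix w k assume w: "w \<in> closure S" "a = (w $ k) ^ m"
    have "cmod (w $ k) \<le> 1" using closure_S_polydisc[OF w(1)] .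
    moreover have "\<not> cmod (w $ k) < 1" using assms w(2) norm_power_less_1_iff[OF m, of "w $ k"] by simp
    ultimately have "cmod (w $ k) = 1" by simp
    then show "w \<in> (\<Union>k'. \<Union>b\<in>{b. b ^ m = (w $ k) ^ m \<and> cmod b = 1}. {w \<in> closure S. w $ k' = b})"
      using w(1) by auto
  qed
  have "finite {b. b ^ m = a}"
  proof -
    have "{b. b ^ m = a} = {b. poly (monom 1 m - [:a:]) b = 0}" by (auto simp: poly_monom)
    moreover have "coeff (monom 1 m - [:a:]) m = 1" using m by (cases m) (auto simp: coeff_pCons)
    then have "monom 1 m - [:a:] \<noteq> 0" by (metis coeff_0 zero_neq_one)
    ultimately show ?thesis using poly_roots_finite by metis
  qed
  then have "finite {b. b ^ m = a \<and> cmod b = 1}" by (rule rev_finite_subset) auto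
  then show "finite (\<Union>k. \<Union>b\<in>{b. b ^ m = a \<and> cmod b = 1}. {w \<in> closure S. w $ k = b})"
    using finite_boundary_fibre by auto
qed

text \<open>The separating polynomial is \<open>f * g\<close>, where \<open>f\<close> kills the peak
  points and \<open>g\<close> is the symmetric sum of the \<open>N\<close>-th powers of
  \<open>v\<close>. It is bounded by 1/4 on the closure and exceeds 1/4 at \<open>x\<close>.\<close>

lemma separate_point:
  assumes x: "x \<in> V" "x \<notin> closure \<Omega>"
  shows "\<exists>f\<in>polyfun UNIV. \<exists>B. (\<forall>z\<in>closure \<Omega>. cmod (f z) \<le> B) \<and> B < cmod (f x)"
proof -
  define n where "n = real CARD('n)"
  have n: "n \<ge> 1" by (simp add: n_def Suc_le_eq)
  obtain z where z: "theta m p z = x" using theta_surj[OF m p pm] .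
  obtain j where j: "\<And>k. cmod ((z $ k) ^ m) \<le> cmod ((z $ j) ^ m)"
  proof -
    have "Max (range (\<lambda>k. cmod ((z $ k) ^ m))) \<in> range (\<lambda>k. cmod ((z $ k) ^ m))"
      by (rule Max_in) auto
    then obtain j where "cmod ((z $ j) ^ m) = Max (range (\<lambda>k. cmod ((z $ k) ^ m)))"
      by (metis (mono_tags, lifting) imageE)
    then show ?thesis using that[of j] by simp
  qed
  define a where "a = (z $ j) ^ m"
  have a1: "cmod a \<ge> 1"
  proof (rule ccontr)
    assume "\<not> cmod a \<ge> 1"
    then have "cmod ((z $ k) ^ m) < 1" for k using j[of k] unfolding a_def by linarith
    then have "z \<in> polydisc" using norm_power_less_1_iff[OF m] by (simp add: mem_polydisc)
    then have "x \<in> \<Omega>" using z x(1) unfolding \<Omega> Theta_domain_def by blast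
    then show False using x(2) closure_subset by blast
  qed
  \<comment> \<open>This is \<open>1 / (2 * a)\<close> written with the conjugate, so
    \<open>v s\<close> is the midpoint of 1 and \<open>s / a\<close>.\<close>
  define c where "c = cnj a / (2 * (cmod a)\<^sup>2)"
  define v where "v s = 1 / 2 + c * s" for s
  have va: "v a = 1"
    using a1 complex_norm_square[of a] by (auto simp: v_def c_def mult.commute)
  have v_less: "cmod (v s) < 1" if "cmod s \<le> cmod a" "s \<noteq> a" for s
  proof -
    define w where "w = cnj a * s / (cmod a)\<^sup>2"
    have "cmod w = cmod s / cmod a"
      using a1 by (simp add: w_def norm_mult norm_divide power2_eq_square norm_power)
    then have "cmod w \<le> 1" using that(1) a1 by (simp add: divide_le_eq)
    moreover have "w \<noteq> 1"
    proof
      assume "w = 1"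
      then have "cnj a * s = cnj a * a"
        using a1 complex_norm_square[of a] by (auto simp: w_def mult.commute)
      then show False using that(2) a1 by auto
    qed
    moreover have "v s = (1 + w) / 2" by (simp add: v_def c_def w_def add_divide_distrib)
    ultimately show ?thesis using norm_one_plus_less by metis
  qed
  have v_le: "cmod (v s) \<le> 1" if "cmod s \<le> cmod a" for s
    using v_less[OF that] va by (cases "s = a") auto
  define D where "D = {w \<in> closure S. \<exists>k. (w $ k) ^ m = a}"
  have "finite (theta m p ` D)" unfolding D_def using finite_peak_points[OF a1] by simp
  moreover have "x \<notin> theta m p ` D" using x(2) theta_closure_S unfolding D_def by blast
  ultimately obtain f where f: "f \<in> polyfun UNIV" "f x = 1" "\<And>y. y \<in> theta m p ` D \<Longrightarrow> f y = 0"
    using polyfun_separating_finite by metis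
  have cf: "continuous_on A (\<lambda>w. cmod (f (theta m p w)))" for A
    by (intro continuous_on_norm continuous_on_compose2[OF continuous_on_polyfun[OF f(1), of UNIV]
          continuous_on_theta]) auto
  \<comment> \<open>The threshold fits the bound \<open>cmod g \<le> n\<close> valid on all of
    \<open>closure S\<close>: outside \<open>A\<close> the product is at most 1/4 for every
    \<open>N\<close>.\<close>
  define A where "A = {w \<in> closure S. 1 / (4 * n) \<le> cmod (f (theta m p w))}"
  have "compact A"
  proof -
    have "closed {w. 1 / (4 * n) \<le> cmod (f (theta m p w))}"
      by (intro closed_Collect_le cf continuous_on_const)
    moreover have "A = closure S \<inter> {w. 1 / (4 * n) \<le> cmod (f (theta m p w))}" by (auto simp: A_def)
    ultimately show ?thesis using compact_closure_S by (simp add: compact_Int_closed)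
  qed
  have small: "cmod ((w $ k) ^ m) \<le> cmod a" if "w \<in> closure S" for w k
  proof -
    have "cmod ((w $ k) ^ m) \<le> 1"
      using closure_S_polydisc[OF that, of k] by (simp add: norm_power power_le_one)
    then show ?thesis using a1 by simp
  qed
  have "\<forall>k. \<exists>r. r < 1 \<and> (\<forall>w\<in>A. cmod (v ((w $ k) ^ m)) \<le> r)"
  proof
    fix k
    \<comment> \<open>On \<open>A\<close> the function \<open>f\<close> does not vanish, so
      \<open>A\<close> contains no peak point and \<open>v\<close> has modulus below 1 in every
      coordinate.\<close>
    have lt: "cmod (v ((w $ k) ^ m)) < 1" if "w \<in> A" for w
    proof (rule v_less)
      show "cmod ((w $ k) ^ m) \<le> cmod a" using that small by (simp add: A_def)
      show "(w $ k) ^ m \<noteq> a"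
      proof
        assume "(w $ k) ^ m = a"
        then have "f (theta m p w) = 0" using that f(3) by (auto simp: A_def D_def)
        then show False using that n by (simp add: A_def divide_le_0_iff)
      qed
    qed
    have cont: "continuous_on A (\<lambda>w. cmod (v ((w $ k) ^ m)))"
      unfolding v_def by (intro continuous_intros)
    show "\<exists>r. r < 1 \<and> (\<forall>w\<in>A. cmod (v ((w $ k) ^ m)) \<le> r)"
      by (rule compact_bound_less_1[OF \<open>compact A\<close> cont lt])
  qed
  from choice[OF this] obtain R where "\<forall>k. R k < 1 \<and> (\<forall>w\<in>A. cmod (v ((w $ k) ^ m)) \<le> R k)"
    by (elim exE) (rule that)
  then have R: "\<And>k. R k < 1" "\<And>k w. w \<in> A \<Longrightarrow> cmod (v ((w $ k) ^ m)) \<le> R k" by blast+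
  \<comment> \<open>Indices with \<open>(z $ k) ^ m = a\<close> contribute exactly 1 to
    \<open>g x\<close> and get the dummy value 0. The maximum \<open>r\<close> below then bounds
    \<open>v\<close> both on \<open>A\<close> and at the other coordinates of
    \<open>z\<close>.\<close>
  define R' where "R' k = (if (z $ k) ^ m = a then 0 else cmod (v ((z $ k) ^ m)))" for k
  have R'1: "R' k < 1" for k using v_less[of "(z $ k) ^ m"] j[of k] by (simp add: R'_def a_def)
  define r where "r = Max (insert 0 (range R \<union> range R'))"
  have r1: "r < 1" unfolding r_def using R(1) R'1 by (subst Max_less_iff) auto
  have r0: "0 \<le> r" and rR: "R k \<le> r" "R' k \<le> r" for k
    unfolding r_def by (rule Max_ge; simp)+
  obtain M where M: "M \<ge> 0" "\<And>w. w \<in> closure S \<Longrightarrow> cmod (f (theta m p w)) \<le> M"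
  proof -
    have "bounded ((\<lambda>w. cmod (f (theta m p w))) ` closure S)"
      by (intro compact_imp_bounded compact_continuous_image cf compact_closure_S)
    then obtain M where "M > 0" "\<forall>y\<in>(\<lambda>w. cmod (f (theta m p w))) ` closure S. norm y \<le> M"
      unfolding bounded_pos by blast
    then show ?thesis using that[of M] by auto
  qed
  \<comment> \<open>The factor \<open>M + 1\<close> serves two estimates at once: \<open>M\<close>
    bounds \<open>f\<close> on \<open>A\<close>, and 1 covers the remainder of
    \<open>g x\<close>.\<close>
  have "(\<lambda>N. (M + 1) * n * r ^ N) \<longlonglongrightarrow> (M + 1) * n * 0"
    by (intro tendsto_intros LIMSEQ_realpow_zero r0 r1)
  then have "\<forall>\<^sub>F N in sequentially. (M + 1) * n * r ^ N < 1 / 4"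
    by (rule order_tendstoD) simp
  then obtain N where N: "(M + 1) * n * r ^ N < 1 / 4"
    using eventually_sequentially by auto
  obtain g where g: "g \<in> polyfun UNIV"
    "\<And>w :: (complex, 'n) vec. g (theta m p w) = (\<Sum>k\<in>UNIV. poly ([:1 / 2, c:] ^ N) ((w $ k) ^ m))"
    using symmetric_sum_polyfun_theta[OF pm] by metis
  have g': "g (theta m p w) = (\<Sum>k\<in>UNIV. v ((w $ k) ^ m) ^ N)" for w
    by (simp add: g(2) v_def mult.commute)
  have bound: "cmod (f (theta m p w) * g (theta m p w)) \<le> 1 / 4" if w: "w \<in> closure S" for w
  proof (cases "w \<in> A")
    case True
    have "cmod (g (theta m p w)) \<le> (\<Sum>k\<in>(UNIV :: 'n set). r ^ N)"
      unfolding g'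
    proof (rule sum_norm_le)
      fix k :: 'n
      have "cmod (v ((w $ k) ^ m)) \<le> r" using R(2)[OF True, of k] rR(1)[of k] by linarith
      then show "cmod (v ((w $ k) ^ m) ^ N) \<le> r ^ N" by (simp add: norm_power power_mono)
    qed
    then have "cmod (f (theta m p w)) * cmod (g (theta m p w)) \<le> M * (n * r ^ N)"
      using M w by (intro mult_mono) (auto simp: n_def)
    also have "\<dots> \<le> (M + 1) * n * r ^ N" using n r0 by (simp add: algebra_simps)
    finally show ?thesis using N by (simp add: norm_mult)
  next
    case False
    have "cmod (g (theta m p w)) \<le> (\<Sum>k\<in>(UNIV :: 'n set). 1)"
      unfolding g' by (rule sum_norm_le) (use v_le small[OF w] in \<open>auto simp: norm_power power_le_one\<close>)
    then have "cmod (f (theta m p w)) * cmod (g (theta m p w)) \<le> (1 / (4 * n)) * n"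
      using False w n by (intro mult_mono) (auto simp: n_def A_def)
    then show ?thesis using n by (simp add: norm_mult)
  qed
  \<comment> \<open>The indices in \<open>J\<close>, at least \<open>j\<close> itself, add up to
    \<open>card J \<ge> 1\<close>; the others contribute less than 1/4 in total.\<close>
  have "cmod (g x) > 1 / 4"
  proof -
    define J where "J = {k. (z $ k) ^ m = a}"
    have "g x = (\<Sum>k\<in>J. v ((z $ k) ^ m) ^ N) + (\<Sum>k\<in>- J. v ((z $ k) ^ m) ^ N)"
      unfolding z[symmetric] g' by (subst sum.union_disjoint[symmetric]) (auto simp: Compl_partition)
    also have "(\<Sum>k\<in>J. v ((z $ k) ^ m) ^ N) = of_nat (card J)" by (simp add: J_def va)
    finally have "cmod (g x) \<ge> real (card J) - cmod (\<Sum>k\<in>- J. v ((z $ k) ^ m) ^ N)"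
      using norm_diff_ineq[of "of_nat (card J) :: complex"] by simp
    moreover have "cmod (\<Sum>k\<in>- J. v ((z $ k) ^ m) ^ N) \<le> (\<Sum>k\<in>- J. r ^ N)"
    proof (rule sum_norm_le)
      fix k assume "k \<in> - J"
      then have "cmod (v ((z $ k) ^ m)) \<le> r" using rR(2)[of k] by (simp add: R'_def J_def)
      then show "cmod (v ((z $ k) ^ m) ^ N) \<le> r ^ N" by (simp add: norm_power power_mono)
    qed
    moreover have "(\<Sum>k\<in>- J. r ^ N) \<le> n * r ^ N"
      using r0 card_mono[of UNIV "- J"] by (auto simp: n_def intro!: mult_right_mono)
    moreover have "n * r ^ N \<le> (M + 1) * n * r ^ N" using M(1) n r0 by (simp add: algebra_simps)
    moreover have "card J \<ge> 1" using a_def by (auto simp: J_def Suc_le_eq card_gt_0_iff)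
    ultimately show ?thesis using N by linarith
  qed
  moreover have "\<forall>y\<in>closure \<Omega>. cmod (f y * g y) \<le> 1 / 4"
    using bound unfolding theta_closure_S[symmetric] by blast
  ultimately show ?thesis
    by (intro bexI[of _ "\<lambda>y. f y * g y"] exI[of _ "1 / 4"]) (auto simp: f(2) intro: polyfun.mult f(1) g(1))
qed

text \<open>A point outside \<open>V\<close> is separated by a polynomial vanishing on
  \<open>V\<close>, which contains the closure because \<open>V\<close> is closed; points of
  \<open>V\<close> are left to \<open>separate_point\<close>.\<close>

lemma closure_polynomially_convex: "polynomially_convex (closure \<Omega>)"
proof (rule polynomially_convexI)
  show "closure \<Omega> \<noteq> {}" using ne by simp
  fix x assume x: "x \<notin> closure \<Omega>"
  show "\<exists>f\<in>polyfun UNIV. \<exists>B. (\<forall>z\<in>closure \<Omega>. cmod (f z) \<le> B) \<and> B < cmod (f x)"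
  proof (cases "x \<in> V")
    case True
    then show ?thesis using separate_point x by blast
  next
    case False
    then obtain f where f: "f \<in> polyfun UNIV" "\<forall>w\<in>V. f w = 0" "f x \<noteq> 0"
      using algebraic_set_vanishing[OF V] by blast
    have "closure \<Omega> \<subseteq> V" by (rule closure_minimal) (auto simp: \<Omega> closed_algebraic_set[OF V])
    then show ?thesis using f by (intro bexI[of _ f] exI[of _ 0]) auto
  qed
qed

end

theorem theorem2p8:
  fixes m p :: nat and \<Omega> :: "(complex ^ 'n::{finite,linorder}) set"
  assumes "m > 0" and "p > 0" and "p dvd m"
    and "distinguished_variety m p \<Omega>"
  shows "polynomially_convex (closure \<Omega>)"
proof -
  obtain V where "irreducible_algebraic_set V" "\<Omega> = V \<inter> Theta_domain m p"
    using assms(4) unfolding distinguished_variety_def by blast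
  then interpret distinguished m p \<Omega> V
    using assms unfolding distinguished_variety_def irreducible_algebraic_set_def
    by unfold_locales auto
  show ?thesis by (rule closure_polynomially_convex)
qed

end
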